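(* Let $\Sigma$ be a finite alphabet of size $\sigma\ge 2$ (not necessarily constant), and consider the problem of finding all $i$ such that $t[i..i+m-1]$ matches $x$, where $x$ is an arbitrary pattern of length $m$ over $\Sigma\cup\{\phi\}$ containing exactly $g<m$ wildcards $\phi$ and $t$ is a text of length $n$ drawn uniformly at random over $\Sigma$. There is an algorithm ($\textsf{Wp}$) solving this problem with average-case search time $O\!\left(\frac{n(g+\log_\sigma m)}{m}\right)$ whenever $\frac{g}{m}<\frac12-\frac{3\log_\sigma m}{m}$, and no fixed algorithm can do better: for every fixed algorithm (with respect to any fixed permutation of the probing positions) the average-case number of character inspections, for a worst-case pattern with $g$ wildcards, is $\Omega\!\left(\frac{n(g+\log_\sigma m)}{m}\right)$.
   Context: The wildcard $\phi\notin\Sigma$ matches itself and every letter of $\Sigma$: two characters $a,b\in\Sigma\cup\{\phi\}$ correspond, $a\approx^{\phi} b$, if they are equal or at least one of them is $\phi$; two strings of equal length match if they correspond at every position. Strings are indexed from $0$. Model: word RAM with word size $\Omega(\log n)$. The pattern is arbitrary (not random). The characters of the text are independent and uniform over $\Sigma$. Average-case search time is the expected running time (respectively, the expected number of inspected text characters) over the random text, for an arbitrary (worst-case) pattern with $g$ wildcards, not counting the preprocessing of the pattern. Fixed algorithm: consider $t$ partitioned into non-overlapping blocks of size $2m$. Let $(i_1,i_2,\dots,i_{2m})$ be an arbitrary but fixed permutation of $(0,1,\dots,2m-1)$ (chosen independently of the pattern). An algorithm is fixed with respect to $(i_1,\dots,i_{2m})$ if, for every block, the sequence of probing positions (the order in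 which characters of the block are read) is $(i_1,\dots,i_{2m})$, the reading of a block stopping once every possible starting position within it has been either ruled out or declared a match. In this model the task is only to find all factors of $t$ matching $x$ that lie entirely within a block.
   Formalization: In both bounds log_σ m is read as max(1, log_σ m), since for g=0 and m=1, or σ much larger than m, the stated upper bound is unattainable; the text length is taken to be n ≥ m for the upper bound and n ≥ 2m for the lower bound. *)

theory Defs
  imports "HOL-Probability.Probability"
begin

section \<open>Strings with wildcards\<close>

text \<open>The alphabet of size \<open>\<sigma>\<close> is \<open>{..<\<sigma>}\<close>; the wildcard is \<^const>\<open>None\<close>.\<close>

definition corresp :: "nat option \<Rightarrow> nat option \<Rightarrow> bool" where
  "corresp a b \<longleftrightarrow> a = b \<or> a = None \<or> b = None"

definition matches :: "nat option list \<Rightarrow> nat option list \<Rightarrow> bool" where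
  "matches x y \<longleftrightarrow> list_all2 corresp x y"

definition patterns :: "nat \<Rightarrow> nat \<Rightarrow> nat \<Rightarrow> nat option list set" where
  "patterns \<sigma> m g =
     {x. length x = m \<and> set x \<subseteq> insert None (Some ` {..<\<sigma>}) \<and> count_list x None = g}"

definition texts :: "nat \<Rightarrow> nat \<Rightarrow> nat list set" where
  "texts \<sigma> n = {t. length t = n \<and> set t \<subseteq> {..<\<sigma>}}"

definition occurs_at :: "nat option list \<Rightarrow> nat list \<Rightarrow> nat \<Rightarrow> bool" where
  "occurs_at x t i \<longleftrightarrow>
     i + length x \<le> length t \<and> matches x (map Some (take (length x) (drop i t)))"

definition random_text :: "nat \<Rightarrow> nat \<Rightarrow> nat list pmf" where
  "random_text \<sigma> n = replicate_pmf n (pmf_of_set {..<\<sigma>})"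

text \<open>
  The quantity \<open>n (g + log\<^sub>\<sigma> m) / m\<close> inside the asymptotic bounds. As usual there, a logarithm
  below 1 counts as 1: for \<open>g = 0\<close> and \<open>m = 1\<close>, or \<open>\<sigma>\<close> much larger than \<open>m\<close>, the literal
  quantity would be 0 or \<open>o (n / m)\<close>, although every correct algorithm has to read at
  least one character of each factor of length \<open>m\<close>.
\<close>

definition cost_bound :: "nat \<Rightarrow> nat \<Rightarrow> nat \<Rightarrow> nat \<Rightarrow> real" where
  "cost_bound \<sigma> m g n = real n * (real g + max 1 (log (real \<sigma>) (real m))) / real m"


section \<open>The word RAM\<close>

text \<open>
  A program has finitely many registers (those named in it) and a memory, all holding
  words of \<open>w\<close> bits, i.e. numbers below \<open>2 ^ w\<close>; since addresses are words, only
  the cells below \<open>2 ^ w\<close> are accessible. The text is a separate read-only random-access input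
  with one character per word, and the output is write-only. Each instruction and each
  evaluation of a branch condition takes one time unit. Programs do not know \<open>w\<close>.
\<close>

datatype binop = Add | Sub | Mul | Div | Mod | And | Or | Xor | Shl | Shr | Less | Eq

fun binop_sem :: "nat \<Rightarrow> binop \<Rightarrow> nat \<Rightarrow> nat \<Rightarrow> nat" where
  "binop_sem w Add a b = take_bit w (a + b)"
| "binop_sem w Sub a b = nat ((int a - int b) mod 2 ^ w)"
| "binop_sem w Mul a b = take_bit w (a * b)"
| "binop_sem w Div a b = a div b"
| "binop_sem w Mod a b = a mod b"
| "binop_sem w And a b = Bit_Operations.and a b"
| "binop_sem w Or a b = Bit_Operations.or a b"
| "binop_sem w Xor a b = Bit_Operations.xor a b"
| "binop_sem w Shl a b = take_bit w (push_bit b a)"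
| "binop_sem w Shr a b = drop_bit b a"
| "binop_sem w Less a b = (if a < b then 1 else 0)"
| "binop_sem w Eq a b = (if a = b then 1 else 0)"

text \<open>Except in \<open>Const\<close>, the arguments are register numbers; the target comes first.\<close>

datatype instr =
    Const nat nat
  | Binop binop nat nat nat
  | Load nat nat
  | Store nat nat
  | TextLen nat
  | TextChar nat nat
  | Output nat

record state =
  regs :: "nat \<Rightarrow> nat"
  mem :: "nat \<Rightarrow> nat"
  outp :: "nat list"

fun step :: "nat \<Rightarrow> nat list \<Rightarrow> instr \<Rightarrow> state \<Rightarrow> state" where
  "step w t (Const r v) s = s\<lparr>regs := (regs s)(r := take_bit w v)\<rparr>"
| "step w t (Binop f r a b) s =
     s\<lparr>regs := (regs s)(r := binop_sem w f (regs s a) (regs s b))\<rparr>"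
| "step w t (Load r a) s = s\<lparr>regs := (regs s)(r := mem s (regs s a))\<rparr>"
| "step w t (Store a r) s = s\<lparr>mem := (mem s)(regs s a := regs s r)\<rparr>"
| "step w t (TextLen r) s = s\<lparr>regs := (regs s)(r := take_bit w (length t))\<rparr>"
| "step w t (TextChar r a) s =
     s\<lparr>regs := (regs s)(r := (if regs s a < length t then take_bit w (t ! regs s a) else 0))\<rparr>"
| "step w t (Output r) s = s\<lparr>outp := outp s @ [regs s r]\<rparr>"

datatype prog =
    Instr instr
  | Seq prog prog
  | Cond nat prog prog
  | While nat prog

text \<open>\<open>exec w t p s k s'\<close>: with word size \<open>w\<close> and text \<open>t\<close>, the program \<open>p\<close> started in \<open>s\<close>
  halts in \<open>s'\<close> after \<open>k\<close> time units.\<close>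

inductive exec :: "nat \<Rightarrow> nat list \<Rightarrow> prog \<Rightarrow> state \<Rightarrow> nat \<Rightarrow> state \<Rightarrow> bool" for w t where
  Instr: "exec w t (Instr i) s 1 (step w t i s)"
| Seq: "exec w t p s k s' \<Longrightarrow> exec w t q s' l s'' \<Longrightarrow> exec w t (Seq p q) s (k + l) s''"
| CondTrue: "regs s r \<noteq> 0 \<Longrightarrow> exec w t p s k s' \<Longrightarrow> exec w t (Cond r p q) s (k + 1) s'"
| CondFalse: "regs s r = 0 \<Longrightarrow> exec w t q s k s' \<Longrightarrow> exec w t (Cond r p q) s (k + 1) s'"
| WhileFalse: "regs s r = 0 \<Longrightarrow> exec w t (While r p) s 1 s"
| WhileTrue: "regs s r \<noteq> 0 \<Longrightarrow> exec w t p s k s' \<Longrightarrow> exec w t (While r p) s' l s'' \<Longrightarrow>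
    exec w t (While r p) s (k + l + 1) s''"

text \<open>Initially register 0 holds \<open>m\<close>, register 1 holds \<open>\<sigma>\<close>, and cells \<open>0, \<dots>, m - 1\<close> hold the
  pattern, the wildcard being encoded as \<open>\<sigma>\<close>.\<close>

definition init_state :: "nat \<Rightarrow> nat \<Rightarrow> nat option list \<Rightarrow> state" where
  "init_state w \<sigma> x =
     \<lparr>regs = (\<lambda>_. 0)(0 := take_bit w (length x), 1 := take_bit w \<sigma>),
      mem = (\<lambda>i. if i < length x then (case x ! i of None \<Rightarrow> \<sigma> | Some a \<Rightarrow> a) else 0),
      outp = []\<rparr>"

text \<open>
  A pattern matching algorithm is a preprocessing program \<open>P\<close> followed by a search program \<open>S\<close>.
  The preprocessing sees the pattern, but neither the text nor its length (it runs on the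
  empty text); its time is not counted. The search continues in the state reached by the
  preprocessing.
\<close>

definition solves_matching ::
    "nat \<Rightarrow> prog \<Rightarrow> prog \<Rightarrow> nat \<Rightarrow> nat \<Rightarrow> nat option list \<Rightarrow> bool" where
  "solves_matching w P S \<sigma> n x \<longleftrightarrow>
     (\<exists>k\<^sub>0 s\<^sub>0. exec w [] P (init_state w \<sigma> x) k\<^sub>0 s\<^sub>0 \<and>
       (\<forall>t\<in>texts \<sigma> n. \<exists>k s. exec w t S s\<^sub>0 k s \<and> set (outp s) = {i. occurs_at x t i}))"

definition search_time ::
    "nat \<Rightarrow> prog \<Rightarrow> prog \<Rightarrow> nat \<Rightarrow> nat option list \<Rightarrow> nat list \<Rightarrow> nat" where
  "search_time w P S \<sigma> x t =
     (THE k. \<exists>k\<^sub>0 s\<^sub>0 s. exec w [] P (init_state w \<sigma> x) k\<^sub>0 s\<^sub>0 \<and> exec w t S s\<^sub>0 k s)"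

definition avg_search_time ::
    "nat \<Rightarrow> prog \<Rightarrow> prog \<Rightarrow> nat \<Rightarrow> nat \<Rightarrow> nat option list \<Rightarrow> real" where
  "avg_search_time w P S \<sigma> n x =
     measure_pmf.expectation (random_text \<sigma> n) (\<lambda>t. real (search_time w P S \<sigma> x t))"


section \<open>Fixed algorithms\<close>

text \<open>
  The text is split into blocks of length \<open>2 * m\<close> (an incomplete last block is ignored), each
  of which has the possible starting positions \<open>0, \<dots>, m\<close> and is read in the order \<open>\<pi>\<close>.
  An algorithm may use any sound rule for deciding positions: \<open>V x h cs j\<close> is its verdict on
  position \<open>j\<close> of the current block when \<open>x\<close> is the pattern, \<open>h\<close> the text preceding the block
  (more than the algorithm has read of it), and \<open>cs\<close> the characters read in the block so far, in
  this order. The verdict is \<open>Some False\<close> for ``ruled out'', \<open>Some True\<close> for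
  ``declared a match'', and \<^const>\<open>None\<close> for neither.
\<close>

type_synonym verdict = "nat option list \<Rightarrow> nat list \<Rightarrow> nat list \<Rightarrow> nat \<Rightarrow> bool option"

definition chars_read :: "nat list \<Rightarrow> nat list \<Rightarrow> nat \<Rightarrow> nat list" where
  "chars_read \<pi> u k = map (\<lambda>i. u ! i) (take k \<pi>)"

definition decided ::
    "nat list \<Rightarrow> verdict \<Rightarrow> nat option list \<Rightarrow> nat list \<Rightarrow> nat list \<Rightarrow> nat \<Rightarrow> nat \<Rightarrow> bool" where
  "decided \<pi> V x h u k j \<longleftrightarrow> (\<exists>l\<le>k. V x h (chars_read \<pi> u l) j \<noteq> None)"

definition fixed_algorithm :: "nat \<Rightarrow> nat \<Rightarrow> nat \<Rightarrow> nat list \<Rightarrow> verdict \<Rightarrow> bool" where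
  "fixed_algorithm \<sigma> m g \<pi> V \<longleftrightarrow>
     distinct \<pi> \<and> set \<pi> = {..<2 * m} \<and>
     (\<forall>x\<in>patterns \<sigma> m g. \<forall>h\<in>lists {..<\<sigma>}. \<forall>u\<in>texts \<sigma> (2 * m). \<forall>j\<le>m.
        (\<forall>k\<le>2 * m. \<forall>v. V x h (chars_read \<pi> u k) j = Some v \<longrightarrow> v = occurs_at x u j) \<and>
        decided \<pi> V x h u (2 * m) j)"

definition block_inspections ::
    "nat \<Rightarrow> nat list \<Rightarrow> verdict \<Rightarrow> nat option list \<Rightarrow> nat list \<Rightarrow> nat list \<Rightarrow> nat" where
  "block_inspections m \<pi> V x h u = (LEAST k. \<forall>j\<le>m. decided \<pi> V x h u k j)"

definition inspections ::
    "nat \<Rightarrow> nat list \<Rightarrow> verdict \<Rightarrow> nat option list \<Rightarrow> nat list \<Rightarrow> nat" where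
  "inspections m \<pi> V x t =
     (\<Sum>b<length t div (2 * m).
        block_inspections m \<pi> V x (take (2 * m * b) t) (take (2 * m) (drop (2 * m * b) t)))"

definition avg_inspections ::
    "nat \<Rightarrow> nat \<Rightarrow> nat list \<Rightarrow> verdict \<Rightarrow> nat option list \<Rightarrow> nat \<Rightarrow> real" where
  "avg_inspections \<sigma> m \<pi> V x n =
     measure_pmf.expectation (random_text \<sigma> n) (\<lambda>t. real (inspections m \<pi> V x t))"

end

theory Submission
  imports Defs
begin

text \<open>
  Upper bound. Let \<open>L\<close> be about \<open>log\<^sub>\<sigma> m\<close>, let grams have length \<open>16 L\<close>, and let
  \<open>B = g div (12 L) + 1\<close>. The text is cut into windows, each responsible for a linear number of
  starting positions whose factors all contain the same \<open>B\<close> consecutive grams of the text. Since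
  \<open>12 L B > g\<close>, every occurrence meets one of these grams in a piece of the pattern with fewer than
  \<open>12 L\<close> wildcards. The preprocessing tabulates which grams match some such piece; each piece has
  more than \<open>4 L\<close> letters, so a random gram is in the table with probability at most
  \<open>m \<cdot> m\<^sup>-\<^sup>4\<close>, and the naive verification that a hit triggers, of cost \<open>O(m\<^sup>2)\<close>, is free on average.
  Letters are first mapped to at most \<open>2 m + 1\<close> classes, which keeps the table polynomial in \<open>m\<close>.
  If \<open>4 \<cdot> 16 L B \<ge> 3 m\<close>, every position is verified naively; within the range of the time bound this
  happens only for bounded \<open>m\<close>.

  Lower bound. A position cannot be decided while all probes inside its factor fell on wildcards or
  on matching letters and a letter is still unread. Placing the wildcards under the first \<open>g\<close> probes
  forces \<open>g + 1\<close> probes. For \<open>k\<close> about \<open>log\<^sub>\<sigma> m / 3\<close>, a pattern that contains, at disjoint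
  translates of the set of the first \<open>k\<close> probes, each of the \<open>\<sigma> ^ k\<close> possible contents forces
  \<open>k + 1\<close> probes. Neither argument averages: these numbers of probes are needed for every text.
\<close>


section \<open>Reasoning about programs\<close>

inductive_cases exec_InstrE: "exec w t (Instr i) s k s'"
inductive_cases exec_SeqE: "exec w t (Seq p q) s k s'"
inductive_cases exec_CondE: "exec w t (Cond r p q) s k s'"
inductive_cases exec_WhileE: "exec w t (While r p) s k s'"

text \<open>Needed because \<open>search_time\<close> is a definite description: it denotes the
  actual time only if all halting runs from a given state agree.\<close>

lemma exec_deterministic:
  assumes "exec w t p s k s'" and "exec w t p s k2 s2"
  shows "k2 = k \<and> s2 = s'"
  using assms
proof (induction arbitrary: k2 s2 rule: exec.induct)
  case (Instr i s)
  show ?case by (rule exec_InstrE[OF Instr.prems]) simp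
next
  case (Seq p s k s' q l s'')
  show ?case
  proof (rule exec_SeqE[OF Seq.prems])
    fix k1 s1 l1
    assume "k2 = k1 + l1" "exec w t p s k1 s1" "exec w t q s1 l1 s2"
    then show ?thesis using Seq.IH(1)[of k1 s1] Seq.IH(2)[of l1 s2] by simp
  qed
next
  case (CondTrue s r p k s' q)
  show ?case
  proof (rule exec_CondE[OF CondTrue.prems])
    fix k1
    assume "k2 = Suc k1" "exec w t p s k1 s2"
    then show ?thesis using CondTrue.IH[of k1 s2] by simp
  qed (use CondTrue.hyps in simp_all)
next
  case (CondFalse s r q k s' p)
  show ?case
  proof (rule exec_CondE[OF CondFalse.prems])
    fix k1
    assume "k2 = Suc k1" "exec w t q s k1 s2"
    then show ?thesis using CondFalse.IH[of k1 s2] by simp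
  qed (use CondFalse.hyps in simp_all)
next
  case (WhileFalse s r p)
  show ?case
    by (rule exec_WhileE[OF WhileFalse.prems]) (use WhileFalse.hyps in simp_all)
next
  case (WhileTrue s r p k s' l s'')
  show ?case
  proof (rule exec_WhileE[OF WhileTrue.prems])
    fix k1 s1 l1
    assume "k2 = Suc (k1 + l1)" "exec w t p s k1 s1" "exec w t (While r p) s1 l1 s2"
    then show ?thesis using WhileTrue.IH(1)[of k1 s1] WhileTrue.IH(2)[of l1 s2] by simp
  qed (use WhileTrue.hyps in simp_all)
qed

text \<open>A total-correctness triple with an upper bound on the time. A bound instead of the exact
  time lets the two branches of a conditional share one \<open>T\<close>.\<close>

definition runs :: "nat \<Rightarrow> nat list \<Rightarrow> prog \<Rightarrow> state \<Rightarrow> nat \<Rightarrow> (state \<Rightarrow> bool) \<Rightarrow> bool" where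
  "runs w t p s T Q \<longleftrightarrow> (\<exists>k s'. exec w t p s k s' \<and> k \<le> T \<and> Q s')"

lemma runs_mono:
  assumes "runs w t p s T Q" "T \<le> T'" "\<And>s'. Q s' \<Longrightarrow> Q' s'"
  shows "runs w t p s T' Q'"
  using assms unfolding runs_def by (meson le_trans)

lemma runs_Instr: "Q (step w t i s) \<Longrightarrow> runs w t (Instr i) s 1 Q"
  unfolding runs_def using exec.Instr by blast

lemma runs_Seq:
  assumes "runs w t p s T R" "\<And>s'. R s' \<Longrightarrow> runs w t q s' T' Q"
  shows "runs w t (Seq p q) s (T + T') Q"
  using assms unfolding runs_def by (meson add_mono exec.Seq)

lemma runs_Cond:
  assumes "regs s r \<noteq> 0 \<Longrightarrow> runs w t p s T Q" "regs s r = 0 \<Longrightarrow> runs w t q s T Q"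
  shows "runs w t (Cond r p q) s (T + 1) Q"
  using assms unfolding runs_def by (metis add_le_mono1 exec.CondFalse exec.CondTrue)

text \<open>\<open>I k\<close> is the invariant with \<open>k\<close> iterations left, so the cost
  of an iteration may depend on how many follow it. Each iteration pays 1 for its test; the final 1
  is the failing test.\<close>

lemma runs_While_countdown:
  assumes body: "\<And>k s. I (Suc k) s \<Longrightarrow> runs w t p s (T k) (I k)"
    and counter: "\<And>k s. I k s \<Longrightarrow> regs s c = k"
    and "I k s"
  shows "runs w t (While c p) s ((\<Sum>j<k. T j + 1) + 1) (I 0)"
  using \<open>I k s\<close>
proof (induction k arbitrary: s)
  case 0
  then show ?case using counter[OF 0] unfolding runs_def
    by (auto intro!: exI[of _ 1] exI[of _ s] exec.WhileFalse)
next
  case (Suc k)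
  from body[OF Suc.prems] obtain k1 s1 where 1: "exec w t p s k1 s1" "k1 \<le> T k" "I k s1"
    unfolding runs_def by blast
  from Suc.IH[OF 1(3)] obtain k2 s2
    where 2: "exec w t (While c p) s1 k2 s2" "k2 \<le> (\<Sum>j<k. T j + 1) + 1" "I 0 s2"
    unfolding runs_def by blast
  have "exec w t (While c p) s (k1 + k2 + 1) s2"
    using counter[OF Suc.prems] by (intro exec.WhileTrue[OF _ 1(1) 2(1)]) simp
  moreover have "k1 + k2 + 1 \<le> (\<Sum>j<Suc k. T j + 1) + 1" using 1(2) 2(2) by simp
  ultimately show ?case unfolding runs_def using 2(3) by blast
qed

text \<open>For loops whose time does not matter: the measure gives termination, and the time bound
  is only asserted to exist.\<close>

lemma runs_While_measure:
  assumes body: "\<And>s. I s \<Longrightarrow> regs s c \<noteq> 0 \<Longrightarrow> runs w t p s (T s) (\<lambda>s'. I s' \<and> \<mu> s' < (\<mu> s :: nat))"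
    and "I s"
  shows "\<exists>T'. runs w t (While c p) s T' (\<lambda>s'. I s' \<and> regs s' c = 0)"
  using \<open>I s\<close>
proof (induction "\<mu> s" arbitrary: s rule: less_induct)
  case less
  show ?case
  proof (cases "regs s c = 0")
    case True
    then have "exec w t (While c p) s 1 s" by (rule exec.WhileFalse)
    then show ?thesis unfolding runs_def using less.prems True by blast
  next
    case False
    from body[OF less.prems False] obtain k1 s1 where
      1: "exec w t p s k1 s1" "I s1" "\<mu> s1 < \<mu> s"
      unfolding runs_def by blast
    from less.hyps[OF 1(3,2)] obtain k2 s2 where
      "exec w t (While c p) s1 k2 s2" "I s2 \<and> regs s2 c = 0"
      unfolding runs_def by blast
    with exec.WhileTrue[OF False 1(1)] have "exec w t (While c p) s (k1 + k2 + 1) s2" by blast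
    then show ?thesis unfolding runs_def using \<open>I s2 \<and> regs s2 c = 0\<close> by blast
  qed
qed

text \<open>\<open>prog\<close> has no empty statement, hence the arbitrary value on the empty list,
  which the rules for blocks exclude.\<close>

fun block :: "instr list \<Rightarrow> prog" where
  "block [] = Instr (Const 0 0)"
| "block [i] = Instr i"
| "block (i # is) = Seq (Instr i) (block is)"

lemma runs_block:
  assumes "is \<noteq> []" "Q (fold (step w t) is s)"
  shows "runs w t (block is) s (length is) Q"
  using assms
proof (induction "is" arbitrary: s rule: block.induct)
  case (3 i j "is")
  have "runs w t (Seq (Instr i) (block (j # is))) s (1 + length (j # is)) Q"
    by (rule runs_Seq[where R = "\<lambda>s'. s' = step w t i s", OF runs_Instr]) (use 3 in auto)
  then show ?case by simp
qed (simp_all add: runs_Instr[simplified])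

declare block.simps [simp del]

lemma runs_blockI:
  "is \<noteq> [] \<Longrightarrow> length is \<le> T \<Longrightarrow> Q (fold (step w t) is s) \<Longrightarrow> runs w t (block is) s T Q"
  by (rule runs_mono[OF runs_block])

definition modifies :: "nat set \<Rightarrow> state \<Rightarrow> state \<Rightarrow> bool" where
  "modifies X s s' \<longleftrightarrow> (\<forall>r. r \<notin> X \<longrightarrow> regs s' r = regs s r)"

text \<open>The machine has no move instruction; the bitwise conjunction of a word with itself
  copies it.\<close>

abbreviation Mov :: "nat \<Rightarrow> nat \<Rightarrow> instr" where
  "Mov r a \<equiv> Binop And r a a"

section \<open>Machine arithmetic without overflow\<close>

lemma Sub_nonneg:
  assumes "b \<le> a" "a < 2 ^ w"
  shows "binop_sem w Sub a b = a - b"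
proof -
  have "binop_sem w Sub a b = nat (int (a - b) mod int (2 ^ w))"
    using assms(1) by (simp add: of_nat_diff)
  also have "\<dots> = (a - b) mod 2 ^ w"
    by (simp only: of_nat_mod[symmetric] nat_int)
  finally show ?thesis
    using assms by simp
qed

lemma binop_sem_of_bool:
  "binop_sem w Less a b = of_bool (a < b)"
  "binop_sem w Eq a b = of_bool (a = b)"
  "binop_sem w Or (of_bool P) (of_bool R) = of_bool (P \<or> R)"
  "binop_sem w And (of_bool P) (of_bool R) = of_bool (P \<and> R)"
  by (cases P; cases R; simp)+

lemma binop_sem_no_overflow:
  "a + b < 2 ^ w \<Longrightarrow> binop_sem w Add a b = a + b"
  "a * b < 2 ^ w \<Longrightarrow> binop_sem w Mul a b = a * b"
  by (simp_all add: take_bit_nat_eq_self)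

lemma binop_sem_And_idem: "binop_sem w And a a = a"
  and binop_sem_Or_idem: "binop_sem w Or a a = a"
  by simp_all

lemma binop_sem_zero:
  "binop_sem w And 0 b = 0" "binop_sem w And a 0 = 0"
  "binop_sem w Or 0 b = b" "binop_sem w Or a 0 = a"
  by simp_all

lemma Or_positive_iff: "0 < binop_sem w Or a b \<longleftrightarrow> 0 < a \<or> 0 < b"
  by (simp add: or_eq_0_iff flip: neq0_conv)

definition text_char :: "nat \<Rightarrow> nat list \<Rightarrow> nat \<Rightarrow> nat" where
  "text_char w t p = (if p < length t then take_bit w (t ! p) else 0)"

lemma step_TextChar:
  "step w t (TextChar r a) s = s\<lparr>regs := (regs s)(r := text_char w t (regs s a))\<rparr>"
  by (simp add: text_char_def)

declare step.simps(6) [simp del] step_TextChar [simp]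

text \<open>From here on these operations are simplified through \<open>binop_eval\<close>, whose
  side conditions rule out overflow, instead of through their defining equations.\<close>

declare binop_sem.simps(1,2,3,6,7,11,12) [simp del]

lemmas binop_eval = Sub_nonneg binop_sem_of_bool binop_sem_no_overflow binop_sem_And_idem
  Or_positive_iff binop_sem_zero binop_sem_Or_idem


section \<open>The search program\<close>

text \<open>Registers 0 to 8 hold parameters that the search only reads, among them the class width
  \<open>rD\<close>, the number of classes \<open>rK\<close>, the gram length \<open>rLen\<close>,
  the numbers \<open>rB\<close> of grams and \<open>rH\<close> of starting positions per window, and
  the initial flag \<open>rF0\<close>.\<close>

abbreviation (input) "rM \<equiv> 0 :: nat"
abbreviation (input) "rSig \<equiv> 1 :: nat"
abbreviation (input) "rD \<equiv> 2 :: nat"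
abbreviation (input) "rK \<equiv> 3 :: nat"
abbreviation (input) "rLen \<equiv> 4 :: nat"
abbreviation (input) "rB \<equiv> 5 :: nat"
abbreviation (input) "rH \<equiv> 6 :: nat"
abbreviation (input) "rF0 \<equiv> 7 :: nat"
abbreviation (input) "rOne \<equiv> 8 :: nat"
abbreviation (input) "rN \<equiv> 9 :: nat"
abbreviation (input) "rR \<equiv> 10 :: nat"
abbreviation (input) "rF \<equiv> 11 :: nat"
abbreviation (input) "rb \<equiv> 12 :: nat"
abbreviation (input) "rj \<equiv> 13 :: nat"
abbreviation (input) "rPos \<equiv> 14 :: nat"
abbreviation (input) "rCode \<equiv> 15 :: nat"
abbreviation (input) "rA \<equiv> 16 :: nat"
abbreviation (input) "rV \<equiv> 17 :: nat"
abbreviation (input) "ri \<equiv> 18 :: nat"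
abbreviation (input) "re \<equiv> 19 :: nat"
abbreviation (input) "rOk \<equiv> 20 :: nat"
abbreviation (input) "rTxt \<equiv> 21 :: nat"

definition gram_prog :: prog where
  "gram_prog = While rj (block [TextChar rA rPos, Binop Div rA rA rD, Binop Mul rCode rCode rK,
     Binop Add rCode rCode rA, Binop Add rPos rPos rOne, Binop Sub rj rj rOne])"

text \<open>The table follows the pattern in memory, so the entry of a code has address
  \<open>m\<close> plus the code. \<open>rPos\<close> is not reset between grams, since they are
  consecutive in the text.\<close>

definition scan_prog :: prog where
  "scan_prog = While rb (Seq (block [Const rCode 0, Mov rj rLen]) (Seq gram_prog
     (block [Binop Add rA rM rCode, Load rA rA, Binop Or rF rF rA, Binop Sub rb rb rOne])))"

definition compare_prog :: prog where
  "compare_prog = While rj (block [Binop Sub rj rj rOne, Load rA rj, Binop Add rV ri rj,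
     TextChar rV rV, Binop Eq rV rA rV, Binop Eq rA rA rSig, Binop Or rA rA rV,
     Binop And rOk rOk rA])"

text \<open>\<open>rOk\<close> starts as 0 if the factor would leave the text, so whatever is read
  beyond the end cannot cause an output.\<close>

definition verify_prog :: prog where
  "verify_prog = While re (Seq (block [Binop Sub re re rOne, Binop Add ri rR re,
       Binop Add rA ri rM, Binop Less rA rTxt rA, Binop Sub rOk rOne rA, Mov rj rM])
     (Seq compare_prog (Cond rOk (Instr (Output ri)) (Instr (Mov rA rA)))))"

text \<open>The windows are visited from the last one down, so that \<open>rN\<close> serves both as
  loop counter and as window index.\<close>

definition search_prog :: prog where
  "search_prog = Seq (block [TextLen rTxt, Binop Sub rN rTxt rM, Binop Div rN rN rH,
       Binop Add rN rN rOne])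
     (While rN (Seq (block [Binop Sub rN rN rOne, Binop Mul rR rN rH, Mov rF rF0,
         Binop Add rPos rR rH, Binop Sub rPos rPos rOne, Mov rb rB])
       (Seq scan_prog (Cond rF (Seq (Instr (Mov re rH)) verify_prog) (Instr (Mov rA rA))))))"

section \<open>Codes of grams and the encoding of the pattern\<close>

fun gram_code :: "nat \<Rightarrow> nat \<Rightarrow> nat list \<Rightarrow> nat \<Rightarrow> nat \<Rightarrow> nat" where
  "gram_code D K t p 0 = 0"
| "gram_code D K t p (Suc k) = gram_code D K t p k * K + (t ! (p + k)) div D"

lemma gram_code_less:
  assumes "\<And>i. i < k \<Longrightarrow> (t ! (p + i)) div D < K"
  shows "gram_code D K t p k < K ^ k"
  using assms
proof (induction k)
  case (Suc k)
  then have "gram_code D K t p k + 1 \<le> K ^ k" by (simp add: Suc_leI)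
  then have "(gram_code D K t p k + 1) * K \<le> K ^ Suc k"
    by (metis mult.commute mult_le_mono1 power_Suc)
  then show ?case using Suc.prems[of k] by (simp add: algebra_simps)
qed simp

definition pattern_cell :: "nat \<Rightarrow> nat option list \<Rightarrow> nat \<Rightarrow> nat" where
  "pattern_cell \<sigma> x j = (case x ! j of None \<Rightarrow> \<sigma> | Some a \<Rightarrow> a)"

lemma occurs_at_iff:
  assumes x: "set x \<subseteq> insert None (Some ` {..<\<sigma>})" and t: "set t \<subseteq> {..<\<sigma>}"
  shows "occurs_at x t i \<longleftrightarrow> i + length x \<le> length t \<and>
    (\<forall>j<length x. pattern_cell \<sigma> x j = \<sigma> \<or> pattern_cell \<sigma> x j = t ! (i + j))"
proof -
  have "x ! j = None \<or> (\<exists>a<\<sigma>. x ! j = Some a)" if "j < length x" for j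
    using x that nth_mem by blast
  then have cell: "corresp (x ! j) (Some a) \<longleftrightarrow>
      (pattern_cell \<sigma> x j = \<sigma> \<or> pattern_cell \<sigma> x j = a)" if "j < length x" for j a
    unfolding pattern_cell_def corresp_def using that by (fastforce split: option.splits)
  show ?thesis
    unfolding occurs_at_def matches_def by (auto simp: list_all2_conv_all_nth cell)
qed

lemma texts_nth_less:
  assumes "t \<in> texts \<sigma> n" "p < n"
  shows "t ! p < \<sigma>"
proof -
  have "t ! p \<in> set t" using assms by (simp add: texts_def)
  then show ?thesis using assms(1) unfolding texts_def by blast
qed

text \<open>The state in which the preprocessing leaves the machine. A code in the table is meant to be
  nonzero if its gram may occur in the pattern; \<open>F\<close> forces the verification of every window, and
  is set when the pattern is too short for filtering (\<open>B = 0\<close>).\<close>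

definition search_ready ::
    "nat \<Rightarrow> nat option list \<Rightarrow> nat \<Rightarrow> nat \<Rightarrow> nat \<Rightarrow> nat \<Rightarrow> nat \<Rightarrow> nat \<Rightarrow> (nat \<Rightarrow> bool) \<Rightarrow> state \<Rightarrow> bool" where
  "search_ready \<sigma> x D K l B h F table s \<longleftrightarrow>
     regs s rM = length x \<and> regs s rSig = \<sigma> \<and> regs s rD = D \<and> regs s rK = K \<and>
     regs s rLen = l \<and> regs s rB = B \<and> regs s rH = h \<and> regs s rF0 = F \<and> regs s rOne = 1 \<and>
     (\<forall>j<length x. mem s j = pattern_cell \<sigma> x j) \<and>
     (B \<noteq> 0 \<longrightarrow> (\<forall>c<K ^ l. mem s (length x + c) \<noteq> 0 \<longleftrightarrow> table c))"

text \<open>The grams begin at the last starting position \<open>r + h - 1\<close> of the window. If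
  \<open>B * l + h \<le> length x\<close>, every factor that starts in the window contains all of
  them.\<close>

definition window_flag ::
    "nat \<Rightarrow> nat \<Rightarrow> nat \<Rightarrow> nat \<Rightarrow> nat \<Rightarrow> nat \<Rightarrow> (nat \<Rightarrow> bool) \<Rightarrow> nat list \<Rightarrow> nat \<Rightarrow> bool" where
  "window_flag D K l B h F table t r \<longleftrightarrow>
     F \<noteq> 0 \<or> (\<exists>b<B. table (gram_code D K t (r + h - 1 + b * l) l))"

text \<open>\<open>filter\<close> is the soundness of the table: a window with an occurrence has a
  gram in the table. What concerns grams is assumed for \<open>B \<noteq> 0\<close> only, so that
  verifying every window, with \<open>B = 0\<close>, is a second instance.\<close>

locale prepared =
  fixes w \<sigma> :: nat and x :: "nat option list" and D K l B h F :: nat and table :: "nat \<Rightarrow> bool"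
  assumes x: "set x \<subseteq> insert None (Some ` {..<\<sigma>})"
    and sigma: "\<sigma> < 2 ^ w"
    and h: "1 \<le> h" "h \<le> length x"
    and F: "B = 0 \<Longrightarrow> F \<noteq> 0"
    and B_less: "B < 2 ^ w"
    and fits: "B \<noteq> 0 \<Longrightarrow> B * l + h \<le> length x"
    and address: "B \<noteq> 0 \<Longrightarrow> length x + K ^ l < 2 ^ w"
    and classes: "B \<noteq> 0 \<Longrightarrow> a < \<sigma> \<Longrightarrow> a div D < K"
    and filter: "B \<noteq> 0 \<Longrightarrow> t \<in> texts \<sigma> n \<Longrightarrow> r \<le> i \<Longrightarrow> i < r + h \<Longrightarrow> occurs_at x t i \<Longrightarrow>
      \<exists>b<B. table (gram_code D K t (r + h - 1 + b * l) l)"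
begin

abbreviation "m \<equiv> length x"

abbreviation "env \<equiv> search_ready \<sigma> x D K l B h F table"

lemma env_modifies: "env s \<Longrightarrow> modifies X s s' \<Longrightarrow> X \<inter> {..8} = {} \<Longrightarrow> mem s' = mem s \<Longrightarrow> env s'"
proof -
  assume *: "env s" "modifies X s s'" "X \<inter> {..8} = {}" "mem s' = mem s"
  then have "r \<in> {..8} \<Longrightarrow> regs s' r = regs s r" for r
    unfolding modifies_def by blast
  then show ?thesis using * unfolding search_ready_def by simp
qed

end

text \<open>The bound on \<open>2 * n\<close> keeps sums such as \<open>i + m\<close> of two numbers
  up to \<open>n\<close> within a word.\<close>

locale searching = prepared +
  fixes t :: "nat list" and n :: nat
  assumes t: "t \<in> texts \<sigma> n" and mn: "length x \<le> n" and n: "2 * n < 2 ^ w"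
begin

section \<open>Correctness and time of the search\<close>

lemma length_t: "length t = n"
  using t by (simp add: texts_def)

lemmas t_less = texts_nth_less[OF t]

lemma text_char: "p < n \<Longrightarrow> text_char w t p = t ! p"
  using t_less[of p] sigma by (simp add: text_char_def length_t take_bit_nat_eq_self)

abbreviation "code \<equiv> gram_code D K t"

lemma code_less: "B \<noteq> 0 \<Longrightarrow> p + k \<le> n \<Longrightarrow> code p k < K ^ k"
  by (rule gram_code_less) (auto intro!: classes t_less)

lemma runs_gram:
  assumes "env s" "B \<noteq> 0" "regs s rj = l" "regs s rCode = 0" "regs s rPos = p" "p + l \<le> n"
  shows "runs w t gram_prog s (7 * l + 1) (\<lambda>s'. modifies {rA, rj, rPos, rCode} s s' \<and>
    mem s' = mem s \<and> outp s' = outp s \<and> regs s' rPos = p + l \<and> regs s' rCode = code p l)"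
proof -
  let ?I = "\<lambda>k s'. k \<le> l \<and> modifies {rA, rj, rPos, rCode} s s' \<and> mem s' = mem s \<and>
    outp s' = outp s \<and> regs s' rj = k \<and> regs s' rPos = p + (l - k) \<and>
    regs s' rCode = code p (l - k)"
  have body: "runs w t (block [TextChar rA rPos, Binop Div rA rA rD, Binop Mul rCode rCode rK,
     Binop Add rCode rCode rA, Binop Add rPos rPos rOne, Binop Sub rj rj rOne]) s' 6 (?I k)"
    if I: "?I (Suc k) s'" for k s'
  proof -
    let ?q = "l - Suc k"
    have kl: "Suc k \<le> l" using I by blast
    then have lk: "l - k = Suc ?q" by simp
    have e: "env s'" using env_modifies[OF assms(1)] I by auto
    have 1: "p + ?q < n" using assms(6) kl by linarith
    \<comment> \<open>Every intermediate value of Horner's rule is the code of a prefix, hence below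
      the size \<open>K ^ l\<close> of the table, which is addressable.\<close>
    have "code p (Suc ?q) < K ^ Suc ?q" using 1 assms(2) by (intro code_less) auto
    also have "\<dots> \<le> K ^ l"
      using kl classes[OF assms(2), of 0] t_less[OF 1] by (intro power_increasing) auto
    also have "\<dots> < 2 ^ w" using address[OF assms(2)] by simp
    finally have 2: "code p ?q * K + t ! (p + ?q) div D < 2 ^ w" by simp
    have 3: "code p ?q * K < 2 ^ w" "p + ?q + 1 < 2 ^ w" "Suc k < 2 ^ w"
      using 1 2 n assms(6) kl by linarith+
    have 4: "(p + ?q + 1) = p + (l - k)" using kl by simp
    show ?thesis
      by (rule runs_blockI)
        (use I e 1 2 3 4 lk in \<open>simp_all add: search_ready_def modifies_def text_char binop_eval\<close>)
  qed
  have I: "?I l s" using assms by (simp add: modifies_def)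
  have "runs w t gram_prog s ((\<Sum>j<l. 6 + 1) + 1) (?I 0)"
    unfolding gram_prog_def
    by (rule runs_While_countdown[where I = ?I, OF body _ I]) auto
  then show ?thesis by (rule runs_mono) auto
qed


lemma runs_scan:
  assumes "env s" "regs s rF = F" "regs s rb = B" "regs s rPos = p" "p + B * l \<le> n"
  shows "runs w t scan_prog s (B * (7 * l + 8) + 1) (\<lambda>s'.
    modifies {rA, rj, rPos, rCode, rF, rb} s s' \<and> mem s' = mem s \<and> outp s' = outp s \<and>
    (regs s' rF \<noteq> 0 \<longleftrightarrow> F \<noteq> 0 \<or> (\<exists>b<B. table (code (p + b * l) l))))"
proof -
  let ?X = "{rA, rj, rPos, rCode, rF, rb}"
  \<comment> \<open>\<open>k\<close> counts the grams still to be read, so the first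
    \<open>B - k\<close> have been looked up.\<close>
  let ?I = "\<lambda>k s'. k \<le> B \<and> modifies ?X s s' \<and> mem s' = mem s \<and> outp s' = outp s \<and>
    regs s' rb = k \<and> regs s' rPos = p + (B - k) * l \<and>
    (regs s' rF \<noteq> 0 \<longleftrightarrow> F \<noteq> 0 \<or> (\<exists>b<B - k. table (code (p + b * l) l)))"
  have body: "runs w t (Seq (block [Const rCode 0, Mov rj rLen]) (Seq gram_prog
     (block [Binop Add rA rM rCode, Load rA rA, Binop Or rF rF rA, Binop Sub rb rb rOne])))
     s1 (7 * l + 7) (?I k)"
    if I: "?I (Suc k) s1" for k s1
  proof -
    let ?q = "p + (B - Suc k) * l"
    have kB: "Suc k \<le> B" and B: "B \<noteq> 0" using I by auto
    have Bk: "B - k = Suc (B - Suc k)" using kB by simp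
    have "(B - Suc k) * l + l \<le> B * l"
      using kB by (metis Bk add.commute diff_le_self mult_Suc mult_le_mono1)
    then have q: "?q + l \<le> n" using assms(5) by linarith
    have e: "env s1" by (rule env_modifies[OF assms(1)]) (use I in auto)
    have "runs w t (Seq (block [Const rCode 0, Mov rj rLen]) (Seq gram_prog
        (block [Binop Add rA rM rCode, Load rA rA, Binop Or rF rF rA, Binop Sub rb rb rOne])))
        s1 (2 + ((7 * l + 1) + 4)) (?I k)"
    proof (rule runs_Seq[where R = "\<lambda>s2. modifies {rCode, rj} s1 s2 \<and> mem s2 = mem s1 \<and>
          outp s2 = outp s1 \<and> regs s2 rCode = 0 \<and> regs s2 rj = l"])
      show "runs w t (block [Const rCode 0, Mov rj rLen]) s1 2 (\<lambda>s2. modifies {rCode, rj} s1 s2 \<and>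
          mem s2 = mem s1 \<and> outp s2 = outp s1 \<and> regs s2 rCode = 0 \<and> regs s2 rj = l)"
        by (rule runs_blockI) (use e in \<open>simp_all add: search_ready_def modifies_def binop_eval\<close>)
    next
      fix s2
      assume 2: "modifies {rCode, rj} s1 s2 \<and> mem s2 = mem s1 \<and> outp s2 = outp s1 \<and>
        regs s2 rCode = 0 \<and> regs s2 rj = l"
      have e2: "env s2" by (rule env_modifies[OF e]) (use 2 in auto)
      show "runs w t (Seq gram_prog (block [Binop Add rA rM rCode, Load rA rA, Binop Or rF rF rA,
          Binop Sub rb rb rOne])) s2 ((7 * l + 1) + 4) (?I k)"
      proof (rule runs_Seq[OF runs_gram[OF e2 B, where p = ?q]])
        show "regs s2 rj = l" "regs s2 rCode = 0" "regs s2 rPos = ?q" "?q + l \<le> n"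
          using 2 I q by (auto simp: modifies_def)
      next
        fix s3
        assume 3: "modifies {rA, rj, rPos, rCode} s2 s3 \<and> mem s3 = mem s2 \<and> outp s3 = outp s2 \<and>
          regs s3 rPos = ?q + l \<and> regs s3 rCode = code ?q l"
        have e3: "env s3" by (rule env_modifies[OF e2]) (use 3 in auto)
        have c: "code ?q l < K ^ l" by (rule code_less[OF B q])
        have F3: "regs s3 rF = regs s1 rF" "regs s3 rb = Suc k"
          using 2 3 I by (auto simp: modifies_def)
        have m3: "modifies ?X s s3" "mem s3 = mem s" "outp s3 = outp s"
          using 2 3 I by (auto simp: modifies_def)
        have p3: "regs s3 rPos = p + (B - k) * l" using 3 Bk by simp
        have tab: "mem s (m + code ?q l) \<noteq> 0 \<longleftrightarrow> table (code ?q l)"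
          using assms(1) B c unfolding search_ready_def by blast
        have bd: "m + code ?q l < 2 ^ w" "Suc k < 2 ^ w"
          using c address[OF B] kB B_less by linarith+
        have fl: "(F \<noteq> 0 \<or> (\<exists>b<B - k. table (code (p + b * l) l))) \<longleftrightarrow>
           regs s1 rF \<noteq> 0 \<or> mem s (m + code ?q l) \<noteq> 0"
          unfolding Bk less_Suc_eq tab using I by blast
        show "runs w t (block [Binop Add rA rM rCode, Load rA rA, Binop Or rF rF rA,
            Binop Sub rb rb rOne]) s3 4 (?I k)"
          unfolding fl
          by (rule runs_blockI)
            (use 3 e3 F3 m3 p3 bd kB in \<open>simp_all add: search_ready_def modifies_def binop_eval\<close>)
      qed
    qed
    then show ?thesis by (rule runs_mono) auto
  qed
  have I: "?I B s" using assms by (simp add: modifies_def)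
  have "runs w t scan_prog s ((\<Sum>j<B. 7 * l + 7 + 1) + 1) (?I 0)"
    unfolding scan_prog_def
    by (rule runs_While_countdown[where I = ?I, OF body _ I]) auto
  then show ?thesis by (rule runs_mono) auto
qed

lemma runs_compare:
  assumes "env s" "regs s rj = m" "regs s rOk = of_bool (i + m \<le> n)" "regs s ri = i" "i + m < 2 ^ w"
  shows "runs w t compare_prog s (9 * m + 1) (\<lambda>s'. modifies {rA, rj, rV, rOk} s s' \<and>
    mem s' = mem s \<and> outp s' = outp s \<and> regs s' rOk = of_bool (occurs_at x t i))"
proof -
  let ?ok = "\<lambda>k. i + m \<le> n \<and>
    (\<forall>j. k \<le> j \<longrightarrow> j < m \<longrightarrow> pattern_cell \<sigma> x j = \<sigma> \<or> pattern_cell \<sigma> x j = t ! (i + j))"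
  let ?I = "\<lambda>k s'. k \<le> m \<and> modifies {rA, rj, rV, rOk} s s' \<and> mem s' = mem s \<and>
    outp s' = outp s \<and> regs s' rj = k \<and> regs s' rOk = of_bool (?ok k)"
  have body: "runs w t (block [Binop Sub rj rj rOne, Load rA rj, Binop Add rV ri rj,
     TextChar rV rV, Binop Eq rV rA rV, Binop Eq rA rA rSig, Binop Or rA rA rV,
     Binop And rOk rOk rA]) s1 8 (?I k)"
    if I: "?I (Suc k) s1" for k s1
  proof -
    have km: "Suc k \<le> m" using I by auto
    have e: "env s1" by (rule env_modifies[OF assms(1)]) (use I in auto)
    have i1: "regs s1 ri = i" using I assms by (auto simp: modifies_def)
    have bd: "i + k < 2 ^ w" "Suc k < 2 ^ w" using km assms(5) n mn by linarith+
    \<comment> \<open>If the factor leaves the text, both sides are false, so only characters inside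
      the text need to be known.\<close>
    have ok: "?ok k \<longleftrightarrow> ?ok (Suc k) \<and> (pattern_cell \<sigma> x k = \<sigma> \<or> pattern_cell \<sigma> x k = text_char w t (i + k))"
    proof (cases "i + m \<le> n")
      case True
      then have "text_char w t (i + k) = t ! (i + k)" using km by (simp add: text_char)
      moreover have "k \<le> j \<longleftrightarrow> j = k \<or> Suc k \<le> j" for j by auto
      ultimately show ?thesis using km by auto
    qed simp
    show ?thesis
      unfolding ok
      by (rule runs_blockI)
        (use I e km i1 bd in \<open>simp_all add: search_ready_def modifies_def binop_eval\<close>)
  qed
  have I: "?I m s" using assms by (simp add: modifies_def)
  have "runs w t compare_prog s ((\<Sum>j<m. 8 + 1) + 1) (?I 0)"
    unfolding compare_prog_def
    by (rule runs_While_countdown[where I = ?I, OF body _ I]) auto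
  moreover have "?ok 0 \<longleftrightarrow> occurs_at x t i"
    using occurs_at_iff[OF x, of t i] t unfolding texts_def by auto
  ultimately show ?thesis by (elim runs_mono) auto
qed

lemma runs_verify:
  assumes "env s" "regs s re = h" "regs s rR = r" "regs s rTxt = n" "r + m \<le> n"
  shows "runs w t verify_prog s (h * (9 * m + 10) + 1) (\<lambda>s'.
    modifies {rA, rj, rV, rOk, ri, re} s s' \<and> mem s' = mem s \<and>
    set (outp s') = set (outp s) \<union> {i. r \<le> i \<and> i < r + h \<and> occurs_at x t i})"
proof -
  let ?X = "{rA, rj, rV, rOk, ri, re}"
  let ?I = "\<lambda>k s'. k \<le> h \<and> modifies ?X s s' \<and> mem s' = mem s \<and> regs s' re = k \<and>
    set (outp s') = set (outp s) \<union> {i. r + k \<le> i \<and> i < r + h \<and> occurs_at x t i}"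
  let ?init = "[Binop Sub re re rOne, Binop Add ri rR re,
     Binop Add rA ri rM, Binop Less rA rTxt rA, Binop Sub rOk rOne rA, Mov rj rM]"
  have body: "runs w t (Seq (block ?init)
     (Seq compare_prog (Cond rOk (Instr (Output ri)) (Instr (Mov rA rA))))) s1 (9 * m + 9) (?I k)"
    if I: "?I (Suc k) s1" for k s1
  proof -
    let ?i = "r + k"
    have kh: "Suc k \<le> h" using I by auto
    have e: "env s1" by (rule env_modifies[OF assms(1)]) (use I in auto)
    have r1: "regs s1 rR = r" "regs s1 rTxt = n" using I assms by (auto simp: modifies_def)
    have bd: "?i + m < 2 ^ w" "?i < 2 ^ w" "Suc k < 2 ^ w" "1 < (2 :: nat) ^ w"
      using kh assms(5) n mn h by linarith+
    have neg: "binop_sem w Sub 1 (of_bool (n < ?i + m)) = of_bool (?i + m \<le> n)"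
      using bd(4) by (subst Sub_nonneg) auto
    let ?R = "\<lambda>s2. modifies {re, ri, rA, rOk, rj} s1 s2 \<and> mem s2 = mem s1 \<and>
      outp s2 = outp s1 \<and> regs s2 rj = m \<and> regs s2 re = k \<and> regs s2 ri = ?i \<and>
      regs s2 rOk = of_bool (?i + m \<le> n)"
    have "runs w t (Seq (block ?init)
      (Seq compare_prog (Cond rOk (Instr (Output ri)) (Instr (Mov rA rA)))))
      s1 (6 + ((9 * m + 1) + (1 + 1))) (?I k)"
    proof (rule runs_Seq[where R = ?R])
      show "runs w t (block ?init) s1 6 ?R"
        by (rule runs_blockI)
          (use I e r1 bd neg in \<open>simp_all add: search_ready_def modifies_def binop_eval(2-) Sub_nonneg[of "Suc 0" "Suc k"]\<close>)
    next
      fix s2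
      assume 2: "?R s2"
      have e2: "env s2" by (rule env_modifies[OF e]) (use 2 in auto)
      show "runs w t (Seq compare_prog (Cond rOk (Instr (Output ri)) (Instr (Mov rA rA)))) s2
          ((9 * m + 1) + (1 + 1)) (?I k)"
      proof (rule runs_Seq[OF runs_compare[OF e2, of ?i]])
        show "regs s2 rj = m" "regs s2 rOk = of_bool (?i + m \<le> n)" "regs s2 ri = ?i" "?i + m < 2 ^ w"
          using 2 bd by auto
      next
        fix s3
        assume 3: "modifies {rA, rj, rV, rOk} s2 s3 \<and> mem s3 = mem s2 \<and> outp s3 = outp s2 \<and>
          regs s3 rOk = of_bool (occurs_at x t ?i)"
        have s3: "modifies ?X s s3" "mem s3 = mem s" "regs s3 re = k" "regs s3 ri = ?i"
          "set (outp s3) = set (outp s) \<union> {i. r + Suc k \<le> i \<and> i < r + h \<and> occurs_at x t i}"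
          using I 2 3 by (auto simp: modifies_def)
        have split: "{i. r + k \<le> i \<and> i < r + h \<and> occurs_at x t i} =
           (if occurs_at x t ?i then {?i} else {}) \<union>
           {i. r + Suc k \<le> i \<and> i < r + h \<and> occurs_at x t i}"
          using kh by (auto simp: le_less Suc_le_eq)
        show "runs w t (Cond rOk (Instr (Output ri)) (Instr (Mov rA rA))) s3 (1 + 1) (?I k)"
          unfolding split
          by (rule runs_Cond; rule runs_Instr) (use s3 3 kh in \<open>auto simp: modifies_def\<close>)
      qed
    qed
    then show ?thesis by (rule runs_mono) auto
  qed
  have I: "?I h s" using assms by (auto simp: modifies_def)
  have "runs w t verify_prog s ((\<Sum>j<h. 9 * m + 9 + 1) + 1) (?I 0)"
    unfolding verify_prog_def
    by (rule runs_While_countdown[where I = ?I, OF body _ I]) auto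
  then show ?thesis by (rule runs_mono) auto
qed


abbreviation "flag \<equiv> window_flag D K l B h F table t"

text \<open>The time of a window is a fixed part plus an indicator times the verification cost; in
  this form expectations can be taken window by window.\<close>

lemma runs_search:
  assumes e: "env s" and outp: "outp s = []"
  shows "runs w t search_prog s (6 + (\<Sum>k<(n - m) div h + 1. B * (7 * l + 8) + 11 +
      of_bool (flag (k * h)) * (h * (9 * m + 10) + 1)))
    (\<lambda>s'. set (outp s') = {i. occurs_at x t i})"
proof -
  define N where "N = (n - m) div h + 1"
  \<comment> \<open>The \<open>N\<close> windows cover every position at which the pattern still
    fits into the text.\<close>
  have occ: "i < N * h" if "occurs_at x t i" for i
  proof -
    have "i \<le> n - m" using that unfolding occurs_at_def length_t by linarith
    also have "n - m < N * h"
      unfolding N_def using h by (simp add: algebra_simps)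
        (metis add.commute dividend_less_div_times mult.commute not_less_eq_eq zero_less_iff_neq_zero One_nat_def Suc_le_eq)
    finally show ?thesis .
  qed
  let ?init = "[Binop Sub rN rN rOne, Binop Mul rR rN rH, Mov rF rF0,
         Binop Add rPos rR rH, Binop Sub rPos rPos rOne, Mov rb rB]"
  let ?vb = "Cond rF (Seq (Instr (Mov re rH)) verify_prog) (Instr (Mov rA rA))"
  let ?T = "\<lambda>k. B * (7 * l + 8) + 10 + of_bool (flag (k * h)) * (h * (9 * m + 10) + 1)"
  \<comment> \<open>As windows are visited downwards, with \<open>k\<close> windows left the output
    consists of the occurrences from \<open>k * h\<close> on.\<close>
  let ?I = "\<lambda>k s'. k \<le> N \<and> env s' \<and> regs s' rTxt = n \<and> regs s' rN = k \<and>
    set (outp s') = {i. k * h \<le> i \<and> occurs_at x t i}"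
  have body: "runs w t (Seq (block ?init) (Seq scan_prog ?vb)) s1 (?T k) (?I k)"
    if I: "?I (Suc k) s1" for k s1
  proof -
    let ?r = "k * h"
    have e1: "env s1" using I by blast
    have "k \<le> (n - m) div h" using I unfolding N_def by auto
    then have "k * h \<le> n - m" by (metis div_times_less_eq_dividend le_trans mult_le_mono1)
    then have rm: "?r + m \<le> n" using mn by linarith
    have "k * 1 \<le> k * h" using h by (intro mult_le_mono2)
    then have bd: "?r + h < 2 ^ w" "?r < 2 ^ w" "Suc k < 2 ^ w" "1 \<le> ?r + h"
      using rm h n by linarith+
    have p: "?r + h - 1 + B * l \<le> n"
      using rm h fits by (cases "B = 0") auto
    let ?R = "\<lambda>s2. modifies {rN, rR, rF, rPos, rb} s1 s2 \<and> mem s2 = mem s1 \<and> outp s2 = outp s1 \<and>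
      regs s2 rN = k \<and> regs s2 rR = ?r \<and> regs s2 rF = F \<and> regs s2 rPos = ?r + h - 1 \<and>
      regs s2 rb = B"
    let ?V = "if flag ?r then h * (9 * m + 10) + 2 else 1"
    have "runs w t (Seq (block ?init) (Seq scan_prog ?vb))
      s1 (6 + ((B * (7 * l + 8) + 1) + (?V + 1))) (?I k)"
    proof (rule runs_Seq[where R = ?R])
      show "runs w t (block ?init) s1 6 ?R"
        by (rule runs_blockI)
          (use I e1 bd in \<open>simp_all add: search_ready_def modifies_def binop_eval\<close>)
    next
      fix s2
      assume 2: "?R s2"
      have e2: "env s2" by (rule env_modifies[OF e1]) (use 2 in auto)
      show "runs w t (Seq scan_prog ?vb) s2 ((B * (7 * l + 8) + 1) + (?V + 1)) (?I k)"
      proof (rule runs_Seq[OF runs_scan[OF e2, where p = "?r + h - 1"]])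
        show "regs s2 rF = F" "regs s2 rb = B" "regs s2 rPos = ?r + h - 1" "?r + h - 1 + B * l \<le> n"
          using 2 p by auto
      next
        fix s3
        assume "modifies {rA, rj, rPos, rCode, rF, rb} s2 s3 \<and> mem s3 = mem s2 \<and> outp s3 = outp s2 \<and>
          (regs s3 rF \<noteq> 0 \<longleftrightarrow> F \<noteq> 0 \<or> (\<exists>b<B. table (code (?r + h - 1 + b * l) l)))"
        then have 3: "modifies {rA, rj, rPos, rCode, rF, rb} s2 s3" "mem s3 = mem s2"
          "outp s3 = outp s2" "regs s3 rF \<noteq> 0 \<longleftrightarrow> flag ?r" unfolding window_flag_def by blast+
        have e3: "env s3" by (rule env_modifies[OF e2]) (use 3 in auto)
        have s3: "regs s3 rTxt = n" "regs s3 rN = k" "regs s3 rR = ?r" "outp s3 = outp s1"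
          using 2 3 I by (auto simp: modifies_def)
        have kN: "k \<le> N" using I by auto
        have split: "{i. k * h \<le> i \<and> occurs_at x t i} =
           {i. ?r \<le> i \<and> i < ?r + h \<and> occurs_at x t i} \<union> {i. Suc k * h \<le> i \<and> occurs_at x t i}"
          by (auto simp: not_less)
        have out1: "set (outp s1) = {i. Suc k * h \<le> i \<and> occurs_at x t i}" using I by blast
        show "runs w t ?vb s3 (?V + 1) (?I k)"
        proof (rule runs_Cond)
          assume "regs s3 rF \<noteq> 0"
          then have "flag ?r" using 3 by blast
          have "runs w t (Seq (Instr (Mov re rH)) verify_prog) s3 (1 + (h * (9 * m + 10) + 1)) (?I k)"
          proof (rule runs_Seq[OF runs_Instr])
            let ?P = "\<lambda>s4. modifies {re} s3 s4 \<and> mem s4 = mem s3 \<and> outp s4 = outp s3 \<and> regs s4 re = h"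
            show "?P (step w t (Mov re rH) s3)"
              using e3 by (simp add: search_ready_def modifies_def binop_eval)
            fix s4 assume 4: "?P s4"
            have e4: "env s4" by (rule env_modifies[OF e3]) (use 4 in auto)
            have s4: "regs s4 rTxt = n" "regs s4 rN = k" "regs s4 rR = ?r"
              using 4 s3 by (auto simp: modifies_def)
            show "runs w t verify_prog s4 (h * (9 * m + 10) + 1) (?I k)"
            proof (rule runs_mono[OF runs_verify[OF e4]])
              show "regs s4 re = h" "regs s4 rR = ?r" "regs s4 rTxt = n" "?r + m \<le> n"
                using 4 s4 rm by auto
              fix s5
              assume 5: "modifies {rA, rj, rV, rOk, ri, re} s4 s5 \<and> mem s5 = mem s4 \<and>
                set (outp s5) = set (outp s4) \<union> {i. ?r \<le> i \<and> i < ?r + h \<and> occurs_at x t i}"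
              have e5: "env s5" by (rule env_modifies[OF e4]) (use 5 in auto)
              have "set (outp s5) = {i. k * h \<le> i \<and> occurs_at x t i}"
                unfolding split using 4 5 s3 out1 by auto
              then show "?I k s5" using 5 kN e5 s4 by (auto simp: modifies_def)
            qed simp
          qed
          then show "runs w t (Seq (Instr (Mov re rH)) verify_prog) s3 ?V (?I k)"
            using \<open>flag ?r\<close> by simp
        next
          assume "regs s3 rF = 0"
          then have nf: "\<not> flag ?r" using 3 by blast
          \<comment> \<open>An unflagged window has \<open>B \<noteq> 0\<close>, as
            \<open>B = 0\<close> forces the flag; then \<open>filter\<close> excludes occurrences in
            it.\<close>
          have "B \<noteq> 0" using F nf unfolding window_flag_def by blast
          then have "{i. ?r \<le> i \<and> i < ?r + h \<and> occurs_at x t i} = {}"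
            using filter[OF _ t] nf unfolding window_flag_def by blast
          then have "{i. k * h \<le> i \<and> occurs_at x t i} = set (outp s3)"
            unfolding split s3 out1 by (metis sup_bot_left)
          then have "?I k (step w t (Mov rA rA) s3)"
            using e3 s3 kN by (simp add: search_ready_def)
          from runs_Instr[where Q = "?I k", OF this]
          show "runs w t (Instr (Mov rA rA)) s3 ?V (?I k)"
            using nf by simp
        qed
      qed
    qed
    then show ?thesis by (rule runs_mono) auto
  qed
  have "runs w t search_prog s (4 + ((\<Sum>k<N. ?T k + 1) + 1)) (?I 0)"
    unfolding search_prog_def
  proof (rule runs_Seq)
    have "n < 2 ^ w" "1 < (2 :: nat) ^ w" using n mn h by linarith+
    moreover have "(n - m) div h + 1 < 2 ^ w"
      using n mn h div_le_dividend[of "n - m" h] by linarith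
    ultimately show "runs w t (block [TextLen rTxt, Binop Sub rN rTxt rM, Binop Div rN rN rH,
        Binop Add rN rN rOne]) s 4 (?I N)"
      by (intro runs_blockI) (use e outp mn occ in \<open>auto simp: search_ready_def length_t binop_eval
        take_bit_nat_eq_self N_def not_le\<close>)
    fix s1 assume "?I N s1"
    then show "runs w t (While rN (Seq (block ?init) (Seq scan_prog ?vb))) s1
        ((\<Sum>k<N. ?T k + 1) + 1) (?I 0)"
      by (intro runs_While_countdown[where I = ?I, OF body]) auto
  qed
  then show ?thesis by (rule runs_mono) (auto simp: N_def sum.distrib algebra_simps)
qed

end


section \<open>The preprocessing program\<close>

text \<open>The preprocessing runs on the empty text and its time is not counted, so the bound is
  existential.\<close>

definition halts :: "nat \<Rightarrow> prog \<Rightarrow> state \<Rightarrow> (state \<Rightarrow> bool) \<Rightarrow> bool" where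
  "halts w p s Q \<longleftrightarrow> (\<exists>T. runs w [] p s T Q)"

lemma halts_mono: "halts w p s R \<Longrightarrow> (\<And>s'. R s' \<Longrightarrow> Q s') \<Longrightarrow> halts w p s Q"
  unfolding halts_def by (meson order_refl runs_mono)

lemma halts_Seq:
  assumes "halts w p s R" "\<And>s'. R s' \<Longrightarrow> halts w q s' Q"
  shows "halts w (Seq p q) s Q"
  using assms unfolding halts_def runs_def by (meson exec.Seq order_refl)

lemma halts_Cond:
  assumes "regs s r \<noteq> 0 \<Longrightarrow> halts w p s Q" "regs s r = 0 \<Longrightarrow> halts w q s Q"
  shows "halts w (Cond r p q) s Q"
  using assms unfolding halts_def runs_def by (meson exec.CondFalse exec.CondTrue order_refl)

lemma halts_block: "is \<noteq> [] \<Longrightarrow> Q (fold (step w []) is s) \<Longrightarrow> halts w (block is) s Q"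
  unfolding halts_def using runs_block by blast

lemma halts_Instr: "Q (step w [] i s) \<Longrightarrow> halts w (Instr i) s Q"
  unfolding halts_def using runs_Instr by blast

lemma halts_While_measure:
  assumes body: "\<And>s. I s \<Longrightarrow> regs s c \<noteq> 0 \<Longrightarrow> halts w p s (\<lambda>s'. I s' \<and> \<mu> s' < (\<mu> s :: nat))"
    and "I s"
  shows "halts w (While c p) s (\<lambda>s'. I s' \<and> regs s' c = 0)"
proof -
  have "\<exists>T. \<forall>s. I s \<and> regs s c \<noteq> 0 \<longrightarrow> runs w [] p s (T s) (\<lambda>s'. I s' \<and> \<mu> s' < \<mu> s)"
    using body unfolding halts_def by metis
  then show ?thesis
    unfolding halts_def using runs_While_measure[of I c w "[]" p _ \<mu>] \<open>I s\<close> by blast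
qed

lemma halts_While_countdown:
  assumes body: "\<And>k s. I (Suc k) s \<Longrightarrow> halts w p s (I k)"
    and counter: "\<And>k s. I k s \<Longrightarrow> regs s c = k"
    and "I k s"
  shows "halts w (While c p) s (I 0)"
proof -
  have "halts w (While c p) s (\<lambda>s. I (regs s c) s \<and> regs s c = 0)"
  proof (rule halts_While_measure[where \<mu> = "\<lambda>s. regs s c"])
    fix s assume s: "I (regs s c) s" "regs s c \<noteq> 0"
    then obtain k where k: "regs s c = Suc k" using not0_implies_Suc by blast
    show "halts w p s (\<lambda>s'. I (regs s' c) s' \<and> regs s' c < regs s c)"
      by (rule halts_mono[OF body[of k]]) (use s k counter in auto)
  qed (use assms in auto)
  then show ?thesis by (rule halts_mono) auto
qed

section \<open>The preprocessing code\<close>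

abbreviation (input) "rT \<equiv> 22 :: nat"
abbreviation (input) "rL \<equiv> 23 :: nat"
abbreviation (input) "rP \<equiv> 24 :: nat"
abbreviation (input) "rG \<equiv> 25 :: nat"
abbreviation (input) "rQ \<equiv> 26 :: nat"
abbreviation (input) "rC \<equiv> 27 :: nat"
abbreviation (input) "rThr \<equiv> 28 :: nat"
abbreviation (input) "rZ \<equiv> 29 :: nat"
abbreviation (input) "rX \<equiv> 30 :: nat"

text \<open>The last character of a gram is the least significant digit of its code, hence the piece
  of the pattern is compared backwards while digits are split off. Its wildcards are counted on the
  way.\<close>

definition digits_prog :: prog where
  "digits_prog = While rj (block [Binop Sub rj rj rOne, Binop Add rA ri rj, Load rA rA,
     Binop Eq rT rA rSig, Binop Add rG rG rT, Binop Div rA rA rD, Binop Mod rR rZ rK,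
     Binop Div rZ rZ rK, Binop Eq rA rA rR, Binop Or rA rA rT, Binop And rOk rOk rA])"

definition positions_prog :: prog where
  "positions_prog = While ri (Seq (block [Binop Sub ri ri rOne, Const rOk 1, Const rG 0,
       Mov rZ rCode, Mov rj rLen])
     (Seq digits_prog (block [Binop Less rA rG rThr, Binop And rOk rOk rA, Binop Or rV rV rOk])))"

definition table_prog :: prog where
  "table_prog = While rCode (Seq (block [Binop Sub rCode rCode rOne, Const rV 0, Binop Sub ri rM rLen])
     (Seq positions_prog (block [Binop Add rA rM rCode, Store rA rV])))"

definition filter_prog :: prog where
  "filter_prog = Seq (block [Mov rLen rT, Mov rB rV, Const rF0 0, Binop Sub rH rM rQ, Mov rj rLen,
       Const rCode 1])
     (Seq (While rj (block [Binop Sub rj rj rOne, Binop Mul rCode rCode rK])) table_prog)"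

text \<open>The parameters for verifying every position are in place first; they remain in force if
  \<open>m = 1\<close> or if \<open>4 * (16 * L * B) \<ge> 3 * m\<close>. Only otherwise is the
  table built.\<close>

definition preprocess_prog :: prog where
  "preprocess_prog = Seq (block [Const rOne 1, Const rH 1, Const rF0 1, Binop Less rC rOne rM])
     (Cond rC
       (Seq (block [Binop Div rD rSig rM, Binop Less rA rSig rM, Binop Add rD rD rA,
           Binop Div rK rSig rD, Binop Add rK rK rOne, Const rL 1, Mov rP rSig, Binop Less rC rP rM])
       (Seq (While rC (block [Binop Mul rP rP rSig, Binop Add rL rL rOne, Binop Less rC rP rM]))
       (Seq (block [Mov rj rM, Const rG 0])
       (Seq (While rj (block [Binop Sub rj rj rOne, Load rA rj, Binop Eq rA rA rSig, Binop Add rG rG rA]))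
       (Seq (block [Const rA 12, Binop Mul rThr rA rL, Binop Div rV rG rThr, Binop Add rV rV rOne,
           Const rA 16, Binop Mul rT rA rL, Binop Mul rQ rT rV, Const rA 4, Binop Mul rA rA rQ,
           Const rX 3, Binop Mul rX rX rM, Binop Less rC rA rX])
       (Cond rC filter_prog (Instr (Mov rA rA))))))))
       (Instr (Mov rA rA)))"

text \<open>The codes are over classes of \<open>class_width\<close> consecutive letters, so that their number is
  polynomial in \<open>m\<close> even for huge alphabets, while a random letter is still in a given class with
  probability \<open>\<le> max (1 / \<sigma>) (1 / m)\<close>.\<close>

definition class_width :: "nat \<Rightarrow> nat \<Rightarrow> nat" where
  "class_width \<sigma> m = \<sigma> div m + of_bool (\<sigma> < m)"

text \<open>One more than the quotient, because the last class may be incomplete.\<close>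

definition class_count :: "nat \<Rightarrow> nat \<Rightarrow> nat" where
  "class_count \<sigma> m = \<sigma> div class_width \<sigma> m + 1"

text \<open>Characterises the least \<open>L \<ge> 1\<close> with
  \<open>m \<le> \<sigma> ^ L\<close>, that is, the logarithm rounded up but at least 1.\<close>

definition ceil_log :: "nat \<Rightarrow> nat \<Rightarrow> nat \<Rightarrow> bool" where
  "ceil_log \<sigma> m L \<longleftrightarrow> 1 \<le> L \<and> m \<le> \<sigma> ^ L \<and> (1 < L \<longrightarrow> \<sigma> ^ (L - 1) < m)"

text \<open>The recursion consumes the code from its least significant digit, which belongs to the
  last position, in the order of \<open>digits_prog\<close>.\<close>

fun gram_match :: "nat \<Rightarrow> nat option list \<Rightarrow> nat \<Rightarrow> nat \<Rightarrow> nat \<Rightarrow> nat \<Rightarrow> nat \<Rightarrow> bool" where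
  "gram_match \<sigma> x D K i 0 c = True"
| "gram_match \<sigma> x D K i (Suc k) c \<longleftrightarrow>
     (pattern_cell \<sigma> x (i + k) = \<sigma> \<or> pattern_cell \<sigma> x (i + k) div D = c mod K) \<and>
     gram_match \<sigma> x D K i k (c div K)"

lemma gram_match_code:
  assumes "\<And>j. j < k \<Longrightarrow> (t ! (p + j)) div D < K"
  shows "gram_match \<sigma> x D K i k (gram_code D K t p k) \<longleftrightarrow>
    (\<forall>j<k. pattern_cell \<sigma> x (i + j) = \<sigma> \<or> pattern_cell \<sigma> x (i + j) div D = (t ! (p + j)) div D)"
  using assms
proof (induction k)
  case (Suc k)
  have k: "(t ! (p + k)) div D < K" using Suc.prems by simp
  then have "gram_code D K t p (Suc k) mod K = t ! (p + k) div D"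
    "gram_code D K t p (Suc k) div K = gram_code D K t p k" by simp_all
  then show ?case
    using Suc.IH Suc.prems by (simp only: gram_match.simps) (auto simp: less_Suc_eq)
qed simp

definition wildcards :: "nat option list \<Rightarrow> nat \<Rightarrow> nat \<Rightarrow> nat" where
  "wildcards x i k = (\<Sum>j<k. of_bool (x ! (i + j) = None))"

lemma wildcards_le: "wildcards x i k \<le> k"
  unfolding wildcards_def by (induction k) auto

lemma wildcards_all: "wildcards x 0 (length x) = count_list x None"
proof (induction x rule: rev_induct)
  case (snoc a x)
  then show ?case by (auto simp: wildcards_def nth_append)
qed (simp add: wildcards_def)

text \<open>The position \<open>length x - l\<close> is left out: with
  \<open>h = length x - B * l\<close>, the grams of a window end before the last character of every
  factor starting in it.\<close>

definition gram_table :: "nat \<Rightarrow> nat option list \<Rightarrow> nat \<Rightarrow> nat \<Rightarrow> nat \<Rightarrow> nat \<Rightarrow> nat \<Rightarrow> bool" where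
  "gram_table \<sigma> x D K l b c \<longleftrightarrow>
     (\<exists>i<length x - l. wildcards x i l < b \<and> gram_match \<sigma> x D K i l c)"

text \<open>Since \<open>length x \<ge> 2\<close>, the assumption on powers covers numeric constants
  as well, and overflow checks reduce to bounds by a power of the pattern length with exponent below
  100.\<close>

locale preprocessing =
  fixes w \<sigma> :: nat and x :: "nat option list"
  assumes x: "set x \<subseteq> insert None (Some ` {..<\<sigma>})"
    and sigma: "2 \<le> \<sigma>" "\<sigma> < 2 ^ w"
    and m: "2 \<le> length x"
    and m_power_less: "k < 100 \<Longrightarrow> length x ^ k < 2 ^ w"
begin

abbreviation "m \<equiv> length x"
abbreviation "D \<equiv> class_width \<sigma> m"
abbreviation "K \<equiv> class_count \<sigma> m"
abbreviation "g \<equiv> count_list x None"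
abbreviation "cell \<equiv> pattern_cell \<sigma> x"

lemma cell_wild:
  assumes "j < m"
  shows "cell j = \<sigma> \<longleftrightarrow> x ! j = None"
proof -
  have "x ! j \<in> insert None (Some ` {..<\<sigma>})" using x nth_mem[OF assms] by blast
  then show ?thesis by (auto simp: pattern_cell_def)
qed

section \<open>Sizes of the classes\<close>

lemma D_pos: "1 \<le> D"
proof (cases "\<sigma> < m")
  case False
  moreover from False have "0 < \<sigma> div m" using m by (auto simp: div_greater_zero_iff)
  ultimately show ?thesis by (simp add: class_width_def)
qed (simp add: class_width_def)

lemma small_less:
  assumes "k < 2 ^ 10"
  shows "k < (2 :: nat) ^ w"
proof -
  have "k < 2 ^ 10" by (rule assms)
  also have "\<dots> \<le> m ^ 10" using m by (intro power_mono) auto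
  also have "\<dots> < 2 ^ w" by (rule m_power_less) simp
  finally show ?thesis .
qed

text \<open>If \<open>\<sigma> \<ge> m\<close>, then \<open>D = \<sigma> div m\<close> and
  \<open>\<sigma> \<le> D * m + m \<le> 2 * D * m\<close>, so \<open>K \<le> 2 * m + 1\<close> for
  all alphabets; the cube is a power of \<open>m\<close> above this.\<close>

lemma K_le: "K \<le> m ^ 3"
proof -
  have "\<sigma> div D \<le> 2 * m"
  proof (cases "\<sigma> < m")
    case True
    then show ?thesis using div_le_dividend[of \<sigma> D] by linarith
  next
    case False
    then have D: "D = \<sigma> div m" by (simp add: class_width_def)
    have "\<sigma> = D * m + \<sigma> mod m" unfolding D by simp
    also have "\<sigma> mod m \<le> 1 * m" using m mod_less_divisor[of m \<sigma>] by linarith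
    also have "1 * m \<le> D * m" using D_pos by (rule mult_le_mono1)
    finally have "\<sigma> \<le> D * (2 * m)" by (simp add: algebra_simps)
    then have "\<sigma> div D \<le> (D * (2 * m)) div D" by (rule div_le_mono)
    then show ?thesis using D_pos by simp
  qed
  then have "K \<le> 2 * m + 1" by (simp add: class_count_def)
  also have "\<dots> \<le> 2 * (m * 2)" using m by linarith
  also have "\<dots> \<le> m * (m * m)" using m by (intro mult_mono) auto
  finally show ?thesis by (simp add: power3_eq_cube)
qed

section \<open>Correctness of the preprocessing\<close>

definition ready :: "state \<Rightarrow> bool" where
  "ready s \<longleftrightarrow> regs s rM = m \<and> regs s rSig = \<sigma> \<and> regs s rOne = 1 \<and> regs s rD = D \<and> regs s rK = K \<and>
     (\<forall>j<m. mem s j = cell j)"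

lemma ready_modifies:
  "ready s \<Longrightarrow> modifies X s s' \<Longrightarrow> X \<inter> {rM, rSig, rOne, rD, rK} = {} \<Longrightarrow> \<forall>j<m. mem s' j = mem s j \<Longrightarrow>
    ready s'"
  unfolding ready_def modifies_def by auto

lemma halts_ceil_log:
  assumes "ready s" "regs s rL = 1" "regs s rP = \<sigma>" "regs s rC = of_bool (\<sigma> < m)"
  shows "halts w (While rC (block [Binop Mul rP rP rSig, Binop Add rL rL rOne, Binop Less rC rP rM])) s
    (\<lambda>s'. modifies {rP, rL, rC} s s' \<and> mem s' = mem s \<and> outp s' = outp s \<and> ceil_log \<sigma> m (regs s' rL))"
proof -
  let ?I = "\<lambda>s'. modifies {rP, rL, rC} s s' \<and> mem s' = mem s \<and> outp s' = outp s \<and>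
    regs s' rP = \<sigma> ^ regs s' rL \<and> 1 \<le> regs s' rL \<and> (1 < regs s' rL \<longrightarrow> \<sigma> ^ (regs s' rL - 1) < m) \<and>
    regs s' rC = of_bool (regs s' rP < m)"
  have "halts w (While rC (block [Binop Mul rP rP rSig, Binop Add rL rL rOne, Binop Less rC rP rM])) s
    (\<lambda>s'. ?I s' \<and> regs s' rC = 0)"
  proof (rule halts_While_measure[where \<mu> = "\<lambda>s. m - regs s rP"])
    fix s1 assume I: "?I s1" and c: "regs s1 rC \<noteq> 0"
    define L where "L = regs s1 rL"
    have L: "\<sigma> ^ L < m" "1 \<le> L" using I c L_def by auto
    have r: "ready s1" by (rule ready_modifies[OF assms(1)]) (use I in auto)
    \<comment> \<open>Inside the loop \<open>\<sigma> \<le> \<sigma> ^ L < m\<close>, so the next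
      power is at most \<open>m * m\<close> and does not overflow.\<close>
    have "\<sigma> ^ 1 \<le> \<sigma> ^ L" using L sigma by (intro power_increasing) auto
    then have "\<sigma> ^ L * \<sigma> \<le> m * m" using L by (intro mult_mono) auto
    then have 1: "\<sigma> ^ L * \<sigma> < 2 ^ w"
      using m_power_less[of 2] by (simp add: power2_eq_square)
    have "L < \<sigma> ^ L" using sigma by (intro power_gt_expt) auto
    then have 2: "L + 1 < 2 ^ w" using L m_power_less[of 1] by simp
    have 3: "m - \<sigma> ^ L * \<sigma> < m - \<sigma> ^ L" using L sigma by (intro diff_less_mono2) auto
    show "halts w (block [Binop Mul rP rP rSig, Binop Add rL rL rOne, Binop Less rC rP rM]) s1
        (\<lambda>s'. ?I s' \<and> m - regs s' rP < m - regs s1 rP)"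
      by (rule halts_block)
        (use I r L 1 2 3 L_def[symmetric] in \<open>simp_all add: ready_def modifies_def binop_eval mult.commute\<close>)
  qed (use assms sigma in \<open>simp add: modifies_def\<close>)
  then show ?thesis by (rule halts_mono) (auto simp: ceil_log_def)
qed

lemma halts_count:
  assumes "ready s" "regs s rj = m" "regs s rG = 0"
  shows "halts w (While rj (block [Binop Sub rj rj rOne, Load rA rj, Binop Eq rA rA rSig, Binop Add rG rG rA])) s
    (\<lambda>s'. modifies {rj, rA, rG} s s' \<and> mem s' = mem s \<and> outp s' = outp s \<and> regs s' rG = g)"
proof -
  let ?I = "\<lambda>k s'. k \<le> m \<and> modifies {rj, rA, rG} s s' \<and> mem s' = mem s \<and> outp s' = outp s \<and>
    regs s' rj = k \<and> regs s' rG + wildcards x 0 k = g"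
  have "halts w (While rj (block [Binop Sub rj rj rOne, Load rA rj, Binop Eq rA rA rSig, Binop Add rG rG rA])) s
    (?I 0)"
  proof (rule halts_While_countdown[where I = ?I and k = m])
    fix k s1 assume I: "?I (Suc k) s1"
    have r: "ready s1" by (rule ready_modifies[OF assms(1)]) (use I in auto)
    have km: "Suc k \<le> m" using I by blast
    have w: "wildcards x 0 (Suc k) = wildcards x 0 k + of_bool (cell k = \<sigma>)"
      using km cell_wild[of k] by (simp add: wildcards_def)
    have "g \<le> m" by (rule count_le_length)
    then have 1: "regs s1 rG + of_bool (cell k = \<sigma>) < 2 ^ w" "Suc k < 2 ^ w"
      using I km m_power_less[of 1] by (auto simp: w)
    show "halts w (block [Binop Sub rj rj rOne, Load rA rj, Binop Eq rA rA rSig, Binop Add rG rG rA]) s1 (?I k)"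
      by (rule halts_block)
        (use I r w 1 km in \<open>simp_all add: ready_def modifies_def binop_eval\<close>)
  qed (use assms in \<open>simp_all add: modifies_def wildcards_all\<close>)
  then show ?thesis by (rule halts_mono) (auto simp: wildcards_def)
qed


definition table_ready :: "nat \<Rightarrow> nat \<Rightarrow> state \<Rightarrow> bool" where
  "table_ready l b s \<longleftrightarrow> ready s \<and> regs s rLen = l \<and> regs s rThr = b"

lemma table_ready_modifies:
  "table_ready l b s \<Longrightarrow> modifies X s s' \<Longrightarrow> X \<inter> {rM, rSig, rOne, rD, rK, rLen, rThr} = {} \<Longrightarrow>
    \<forall>j<m. mem s' j = mem s j \<Longrightarrow> table_ready l b s'"
  unfolding table_ready_def ready_def modifies_def by auto

lemma halts_digits:
  assumes "table_ready l b s" "regs s rj = l" "regs s ri = i" "regs s rG = 0" "regs s rOk = 1"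
    "regs s rZ = c" "i + l \<le> m"
  shows "halts w digits_prog s (\<lambda>s'. modifies {rj, rA, rT, rG, rR, rZ, rOk} s s' \<and> mem s' = mem s \<and>
    outp s' = outp s \<and> regs s' rG = wildcards x i l \<and> regs s' rOk = of_bool (gram_match \<sigma> x D K i l c))"
proof -
  \<comment> \<open>\<open>P\<close> collects the outcome of the digits already compared. Together
    with the match of the rest of the code in \<open>rZ\<close> it stays equivalent to the match of
    the whole.\<close>
  let ?I = "\<lambda>k s'. k \<le> l \<and> modifies {rj, rA, rT, rG, rR, rZ, rOk} s s' \<and> mem s' = mem s \<and>
    outp s' = outp s \<and> regs s' rj = k \<and> regs s' rG + wildcards x i k = wildcards x i l \<and>
    (\<exists>P. regs s' rOk = of_bool P \<and>
       (P \<and> gram_match \<sigma> x D K i k (regs s' rZ) \<longleftrightarrow> gram_match \<sigma> x D K i l c))"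
  have "halts w digits_prog s (?I 0)"
    unfolding digits_prog_def
  proof (rule halts_While_countdown[where I = ?I and k = l])
    fix k s1 assume I: "?I (Suc k) s1"
    then obtain P where P: "regs s1 rOk = of_bool P"
      "P \<and> gram_match \<sigma> x D K i (Suc k) (regs s1 rZ) \<longleftrightarrow> gram_match \<sigma> x D K i l c" by blast
    have r: "table_ready l b s1" by (rule table_ready_modifies[OF assms(1)]) (use I in auto)
    have km: "Suc k \<le> l" using I by blast
    then have ik: "i + k < m" using assms(7) by linarith
    have w: "wildcards x i (Suc k) = wildcards x i k + of_bool (cell (i + k) = \<sigma>)"
      using ik cell_wild[of "i + k"] by (simp add: wildcards_def)
    have 1: "regs s1 rG + of_bool (cell (i + k) = \<sigma>) < 2 ^ w" "Suc k < 2 ^ w" "i + k < 2 ^ w"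
      using I km ik assms(7) m_power_less[of 1] wildcards_le[of x i l] by (auto simp: w)
    have i1: "regs s1 ri = i" using I assms by (auto simp: modifies_def)
    let ?P = "P \<and> (cell (i + k) div D = regs s1 rZ mod K \<or> cell (i + k) = \<sigma>)"
    have gm: "?P \<and> gram_match \<sigma> x D K i k (regs s1 rZ div K) \<longleftrightarrow> gram_match \<sigma> x D K i l c"
      using P by auto
    let ?is = "[Binop Sub rj rj rOne, Binop Add rA ri rj, Load rA rA,
       Binop Eq rT rA rSig, Binop Add rG rG rT, Binop Div rA rA rD, Binop Mod rR rZ rK,
       Binop Div rZ rZ rK, Binop Eq rA rA rR, Binop Or rA rA rT, Binop And rOk rOk rA]"
    let ?s2 = "fold (step w []) ?is s1"
    have s2: "k \<le> l" "modifies {rj, rA, rT, rG, rR, rZ, rOk} s ?s2" "mem ?s2 = mem s" "outp ?s2 = outp s"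
      "regs ?s2 rj = k" "regs ?s2 rG + wildcards x i k = wildcards x i l"
      "regs ?s2 rOk = of_bool ?P" "regs ?s2 rZ = regs s1 rZ div K"
      using I P(1) r w 1 km ik i1
      by (simp_all add: table_ready_def ready_def modifies_def binop_eval)
    have "?I k ?s2"
      using s2(1-6) s2(7) gm unfolding s2(8) by (intro conjI exI[of _ ?P])
    then show "halts w (block ?is) s1 (?I k)"
      by (rule halts_block[rotated]) simp
  next
    show "?I l s"
      using assms by (intro conjI exI[of _ True]) (simp_all add: modifies_def)
  next
    fix k s1 assume "?I k s1"
    then show "regs s1 rj = k" by blast
  qed
  then show ?thesis by (rule halts_mono) (auto simp: wildcards_def)
qed

lemma halts_positions:
  assumes "table_ready l b s" "regs s rCode = c" "regs s ri = m - l" "regs s rV = 0" "1 \<le> l"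
  shows "halts w positions_prog s (\<lambda>s'. modifies {ri, rj, rA, rT, rG, rR, rZ, rOk, rV} s s' \<and>
    mem s' = mem s \<and> outp s' = outp s \<and> regs s' rV = of_bool (gram_table \<sigma> x D K l b c))"
proof -
  let ?X = "{ri, rj, rA, rT, rG, rR, rZ, rOk, rV}"
  let ?hit = "\<lambda>i. wildcards x i l < b \<and> gram_match \<sigma> x D K i l c"
  let ?I = "\<lambda>k s'. k \<le> m - l \<and> modifies ?X s s' \<and> mem s' = mem s \<and> outp s' = outp s \<and>
    regs s' ri = k \<and> regs s' rV = of_bool (\<exists>i. k \<le> i \<and> i < m - l \<and> ?hit i)"
  let ?init = "[Binop Sub ri ri rOne, Const rOk 1, Const rG 0, Mov rZ rCode, Mov rj rLen]"
  let ?last = "[Binop Less rA rG rThr, Binop And rOk rOk rA, Binop Or rV rV rOk]"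
  have "halts w positions_prog s (?I 0)"
    unfolding positions_prog_def
  proof (rule halts_While_countdown[where I = ?I and k = "m - l"])
    fix k s1 assume I: "?I (Suc k) s1"
    have r: "table_ready l b s1" by (rule table_ready_modifies[OF assms(1)]) (use I in auto)
    have km: "Suc k \<le> m - l" using I by blast
    have c1: "regs s1 rCode = c" using I assms by (auto simp: modifies_def)
    have bd: "Suc k < 2 ^ w" "0 < w"
      using km m_power_less[of 1] m by (auto intro: gr0I)
    let ?R = "\<lambda>s2. modifies ?X s s2 \<and> mem s2 = mem s \<and> outp s2 = outp s \<and> regs s2 ri = k \<and>
      regs s2 rOk = 1 \<and> regs s2 rG = 0 \<and> regs s2 rZ = c \<and> regs s2 rj = l \<and>
      regs s2 rV = of_bool (\<exists>i. Suc k \<le> i \<and> i < m - l \<and> ?hit i)"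
    show "halts w (Seq (block ?init) (Seq digits_prog (block ?last))) s1 (?I k)"
    proof (rule halts_Seq[where R = ?R])
      show "halts w (block ?init) s1 ?R"
        by (rule halts_block)
          (use I r bd c1 in \<open>simp_all add: table_ready_def ready_def modifies_def binop_eval take_bit_nat_eq_self\<close>)
      fix s2 assume 2: "?R s2"
      have r2: "table_ready l b s2" by (rule table_ready_modifies[OF assms(1)]) (use 2 in auto)
      show "halts w (Seq digits_prog (block ?last)) s2 (?I k)"
      proof (rule halts_Seq[OF halts_digits[OF r2, of k c]])
        show "regs s2 rj = l" "regs s2 ri = k" "regs s2 rG = 0" "regs s2 rOk = 1" "regs s2 rZ = c"
          "k + l \<le> m"
          using 2 km by auto
        fix s3
        assume 3: "modifies {rj, rA, rT, rG, rR, rZ, rOk} s2 s3 \<and> mem s3 = mem s2 \<and> outp s3 = outp s2 \<and>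
          regs s3 rG = wildcards x k l \<and> regs s3 rOk = of_bool (gram_match \<sigma> x D K k l c)"
        have r3: "table_ready l b s3" by (rule table_ready_modifies[OF r2]) (use 3 in auto)
        have s3: "modifies ?X s s3" "mem s3 = mem s" "outp s3 = outp s" "regs s3 ri = k"
          "regs s3 rV = of_bool (\<exists>i. Suc k \<le> i \<and> i < m - l \<and> ?hit i)"
          using 2 3 unfolding modifies_def by simp_all
        have "k \<le> i \<longleftrightarrow> i = k \<or> Suc k \<le> i" for i by auto
        then have hit: "(\<exists>i. k \<le> i \<and> i < m - l \<and> ?hit i) \<longleftrightarrow>
          (\<exists>i. Suc k \<le> i \<and> i < m - l \<and> ?hit i) \<or> (gram_match \<sigma> x D K k l c \<and> wildcards x k l < b)"
          using km by (metis (no_types, lifting) Suc_le_lessD)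
        define E where "E \<longleftrightarrow> (\<exists>i. Suc k \<le> i \<and> i < m - l \<and> ?hit i)"
        define H where "H \<longleftrightarrow> gram_match \<sigma> x D K k l c"
        have E: "regs s3 rV = of_bool E" and H: "regs s3 rOk = of_bool H"
          and G: "regs s3 rG = wildcards x k l"
          using s3(5) 3 unfolding E_def H_def by blast+
        have thr: "regs s3 rThr = b" using r3 by (simp add: table_ready_def)
        show "halts w (block ?last) s3 (?I k)"
          unfolding hit E_def[symmetric] H_def[symmetric]
          by (rule halts_block)
            (use s3(1-4) km E H G thr in \<open>simp_all add: modifies_def binop_eval\<close>)
      qed
    qed
  qed (use assms in \<open>auto simp: modifies_def\<close>)
  then show ?thesis by (rule halts_mono) (auto simp: gram_table_def)
qed

lemma halts_table:
  assumes "table_ready l b s" "regs s rCode = M" "1 \<le> l" "l \<le> m" "m + M < 2 ^ w"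
  shows "halts w table_prog s (\<lambda>s'.
    modifies {rCode, ri, rj, rA, rT, rG, rR, rZ, rOk, rV} s s' \<and> outp s' = outp s \<and>
    (\<forall>j<m. mem s' j = mem s j) \<and>
    (\<forall>c<M. mem s' (m + c) = of_bool (gram_table \<sigma> x D K l b c)))"
proof -
  let ?X = "{rCode, ri, rj, rA, rT, rG, rR, rZ, rOk, rV}"
  let ?I = "\<lambda>k s'. k \<le> M \<and> modifies ?X s s' \<and> outp s' = outp s \<and> regs s' rCode = k \<and>
    (\<forall>j<m. mem s' j = mem s j) \<and>
    (\<forall>c. k \<le> c \<longrightarrow> c < M \<longrightarrow> mem s' (m + c) = of_bool (gram_table \<sigma> x D K l b c))"
  let ?init = "[Binop Sub rCode rCode rOne, Const rV 0, Binop Sub ri rM rLen]"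
  let ?last = "[Binop Add rA rM rCode, Store rA rV]"
  have "halts w table_prog s (?I 0)"
    unfolding table_prog_def
  proof (rule halts_While_countdown[where I = ?I and k = M])
    fix k s1 assume I: "?I (Suc k) s1"
    have r: "table_ready l b s1" by (rule table_ready_modifies[OF assms(1)]) (use I in auto)
    have kM: "Suc k \<le> M" using I by blast
    have bd: "Suc k < 2 ^ w" "m < 2 ^ w" "m + k < 2 ^ w" using kM assms(5) by linarith+
    let ?R = "\<lambda>s2. modifies ?X s s2 \<and> mem s2 = mem s1 \<and> outp s2 = outp s \<and> regs s2 rCode = k \<and>
      regs s2 ri = m - l \<and> regs s2 rV = 0"
    show "halts w (Seq (block ?init) (Seq positions_prog (block ?last))) s1 (?I k)"
    proof (rule halts_Seq[where R = ?R])
      show "halts w (block ?init) s1 ?R"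
        by (rule halts_block)
          (use I r bd assms(4) in \<open>simp_all add: table_ready_def ready_def modifies_def binop_eval\<close>)
      fix s2 assume 2: "?R s2"
      have r2: "table_ready l b s2" by (rule table_ready_modifies[OF assms(1)]) (use I 2 in auto)
      show "halts w (Seq positions_prog (block ?last)) s2 (?I k)"
      proof (rule halts_Seq[OF halts_positions[OF r2, of k]])
        show "regs s2 rCode = k" "regs s2 ri = m - l" "regs s2 rV = 0" "1 \<le> l"
          using 2 assms by auto
        fix s3
        assume 3: "modifies {ri, rj, rA, rT, rG, rR, rZ, rOk, rV} s2 s3 \<and>
          mem s3 = mem s2 \<and> outp s3 = outp s2 \<and> regs s3 rV = of_bool (gram_table \<sigma> x D K l b k)"
        have r3: "table_ready l b s3" by (rule table_ready_modifies[OF r2]) (use 3 in auto)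
        have s3: "modifies ?X s s3" "mem s3 = mem s1" "outp s3 = outp s" "regs s3 rCode = k"
          using 2 3 by (auto simp: modifies_def)
        show "halts w (block ?last) s3 (?I k)"
        proof (rule halts_block)
          let ?s4 = "fold (step w []) ?last s3"
          \<comment> \<open>The only store goes to \<open>m + k\<close>, above the pattern and below
            the entries that are already final.\<close>
          have m4: "mem ?s4 = (mem s1)(m + k := of_bool (gram_table \<sigma> x D K l b k))"
            using 3 r3 s3 bd by (simp add: table_ready_def ready_def binop_eval)
          have "mem ?s4 (m + c) = of_bool (gram_table \<sigma> x D K l b c)" if "k \<le> c" "c < M" for c
            using I that unfolding m4 by (cases "c = k") auto
          moreover have "mem ?s4 j = mem s j" if "j < m" for j
            using I that unfolding m4 by auto
          ultimately show "?I k ?s4"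
            using s3 kM by (auto simp: modifies_def)
        qed simp
      qed
    qed
  qed (use assms in \<open>auto simp: modifies_def\<close>)
  then show ?thesis by (rule halts_mono) auto
qed


text \<open>For \<open>L > 1\<close> minimality gives \<open>\<sigma> ^ (L - 1) < m\<close>, and one
  more factor \<open>\<sigma> < m\<close> leads to at most \<open>m ^ 2\<close>.\<close>

lemma ceil_log_power_le:
  assumes "ceil_log \<sigma> m L" "\<sigma> < m"
  shows "\<sigma> ^ L \<le> m ^ 2"
proof (cases "1 < L")
  case True
  then have "\<sigma> ^ L = \<sigma> ^ (L - 1) * \<sigma>" by (cases L) simp_all
  also have "\<dots> \<le> m * m" using assms True unfolding ceil_log_def by (intro mult_mono) auto
  finally show ?thesis by (simp add: power2_eq_square)
next
  case False
  then have "L = 1" using assms unfolding ceil_log_def by auto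
  then have "\<sigma> ^ L \<le> m * 1" using assms by simp
  also have "\<dots> \<le> m * m" using m by (intro mult_le_mono2) auto
  finally show ?thesis by (simp add: power2_eq_square)
qed

lemma ceil_log_large_alphabet: "ceil_log \<sigma> m L \<Longrightarrow> m \<le> \<sigma> \<Longrightarrow> L = 1"
proof (rule ccontr)
  assume L: "ceil_log \<sigma> m L" "m \<le> \<sigma>" "L \<noteq> 1"
  then have "1 \<le> L - 1" "\<sigma> ^ (L - 1) < m" unfolding ceil_log_def by auto
  moreover from this(1) have "\<sigma> ^ 1 \<le> \<sigma> ^ (L - 1)" using sigma by (intro power_increasing) auto
  ultimately show False using L(2) by simp
qed

text \<open>For \<open>\<sigma> < m\<close> the classes are single letters,
  \<open>K = \<sigma> + 1 \<le> \<sigma> ^ 2\<close> and \<open>\<sigma> ^ L \<le> m ^ 2\<close>,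
  whence the exponent 2 * 16 * 2 = 64. For larger alphabets \<open>L = 1\<close> and
  \<open>K \<le> m ^ 3\<close> give 48.\<close>

lemma code_count_le:
  assumes "ceil_log \<sigma> m L"
  shows "K ^ (16 * L) \<le> m ^ 64"
proof (cases "\<sigma> < m")
  case True
  then have "K = \<sigma> + 1" by (simp add: class_count_def class_width_def)
  also have "\<dots> \<le> \<sigma> * 2" using sigma(1) by linarith
  also have "\<dots> \<le> \<sigma> ^ 2" using sigma(1) by (simp add: power2_eq_square)
  finally have "K ^ (16 * L) \<le> (\<sigma> ^ 2) ^ (16 * L)" by (rule power_mono) simp
  also have "\<dots> = (\<sigma> ^ L) ^ 32" by (simp add: mult.commute flip: power_mult)
  also have "\<dots> \<le> (m ^ 2) ^ 32" using ceil_log_power_le[OF assms True] by (rule power_mono) simp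
  finally show ?thesis by (simp flip: power_mult)
next
  case False
  then have "L = 1" using ceil_log_large_alphabet[OF assms] by simp
  then have "K ^ (16 * L) \<le> (m ^ 3) ^ 16" using K_le power_mono[of K "m ^ 3" 16] by simp
  also have "\<dots> = m ^ 48" by (simp flip: power_mult)
  also have "\<dots> \<le> m ^ 64" using m by (intro power_increasing) auto
  finally show ?thesis .
qed

lemma table_fits:
  assumes "ceil_log \<sigma> m L"
  shows "m + K ^ (16 * L) < 2 ^ w"
proof -
  have "m ^ 1 \<le> m ^ 64" using m by (intro power_increasing) auto
  then have "m + K ^ (16 * L) \<le> 2 * m ^ 64" using code_count_le[OF assms] by simp
  also have "\<dots> \<le> m * m ^ 64" using m by (rule mult_le_mono1)
  also have "\<dots> = m ^ 65" by (simp flip: power_Suc)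
  also have "\<dots> < 2 ^ w" by (rule m_power_less) simp
  finally show ?thesis .
qed

lemma halts_filter:
  assumes "ready s" "regs s rT = l" "regs s rV = B" "regs s rQ = l * B" "regs s rThr = b"
    "1 \<le> l" "1 \<le> B" "l * B \<le> m" "m + K ^ l < 2 ^ w" "outp s = []"
  shows "halts w filter_prog s (\<lambda>s'. outp s' = [] \<and>
    search_ready \<sigma> x D K l B (m - l * B) 0 (gram_table \<sigma> x D K l b) s')"
proof -
  let ?init = "[Mov rLen rT, Mov rB rV, Const rF0 0, Binop Sub rH rM rQ, Mov rj rLen, Const rCode 1]"
  let ?E = "\<lambda>s. regs s rB = B \<and> regs s rF0 = 0 \<and> regs s rH = m - l * B \<and> outp s = []"
  let ?R = "\<lambda>s1. table_ready l b s1 \<and> ?E s1 \<and> regs s1 rj = l \<and> regs s1 rCode = 1"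
  have "1 \<le> K" by (simp add: class_count_def)
  have w: "0 < w" using small_less[of 1] by (cases w) auto
  have mw: "m < 2 ^ w" using assms(9) by linarith
  have "l * 1 \<le> l * B" using assms by (intro mult_le_mono2) simp
  then have lm: "l \<le> m" using assms by linarith
  have prepared: "search_ready \<sigma> x D K l B (m - l * B) 0 (gram_table \<sigma> x D K l b) s'"
    if "table_ready l b s'" "?E s'" "\<forall>c<K ^ l. mem s' (m + c) = of_bool (gram_table \<sigma> x D K l b c)" for s'
    using that unfolding table_ready_def ready_def by (simp add: search_ready_def)
  show ?thesis
    unfolding filter_prog_def
  proof (rule halts_Seq[where R = ?R])
    show "halts w (block ?init) s ?R"
      by (rule halts_block)
        (use assms w mw in \<open>simp_all add: table_ready_def ready_def binop_eval\<close>)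
    fix s1 assume 1: "?R s1"
    let ?R2 = "\<lambda>s2. table_ready l b s2 \<and> ?E s2 \<and> regs s2 rCode = K ^ l"
    let ?I = "\<lambda>k s2. k \<le> l \<and> table_ready l b s2 \<and> ?E s2 \<and> regs s2 rj = k \<and> regs s2 rCode = K ^ (l - k)"
    let ?body = "block [Binop Sub rj rj rOne, Binop Mul rCode rCode rK]"
    show "halts w (Seq (While rj ?body) table_prog) s1 (\<lambda>s'. outp s' = [] \<and>
        search_ready \<sigma> x D K l B (m - l * B) 0 (gram_table \<sigma> x D K l b) s')"
    proof (rule halts_Seq[where R = ?R2])
      have "halts w (While rj ?body) s1 (?I 0)"
      proof (rule halts_While_countdown[where I = ?I and k = l])
        fix k s2 assume I: "?I (Suc k) s2"
        have kl: "Suc k \<le> l" using I by blast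
        have Kp: "K ^ (l - Suc k) * K = K ^ (l - k)"
          using Suc_diff_le[OF kl] by (simp add: mult.commute)
        have "K ^ (l - k) \<le> K ^ l" using \<open>1 \<le> K\<close> by (intro power_increasing) auto
        then have bd: "K ^ (l - k) < 2 ^ w" "Suc k < 2 ^ w" using kl lm assms(9) by linarith+
        show "halts w ?body s2 (?I k)"
          by (rule halts_block)
            (use I kl Kp bd in \<open>simp_all add: table_ready_def ready_def binop_eval\<close>)
      next
        show "?I l s1" using 1 by simp
      qed blast
      then show "halts w (While rj ?body) s1 ?R2" by (rule halts_mono) simp
    next
      fix s2 assume 2: "?R2 s2"
      show "halts w table_prog s2 (\<lambda>s'. outp s' = [] \<and>
          search_ready \<sigma> x D K l B (m - l * B) 0 (gram_table \<sigma> x D K l b) s')"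
      proof (rule halts_mono[OF halts_table[of l b s2 "K ^ l"]])
        show "table_ready l b s2" "regs s2 rCode = K ^ l" "1 \<le> l" "l \<le> m" "m + K ^ l < 2 ^ w"
          using 2 assms lm by auto
        fix s3
        assume 3: "modifies {rCode, ri, rj, rA, rT, rG, rR, rZ, rOk, rV} s2 s3 \<and> outp s3 = outp s2 \<and>
          (\<forall>j<m. mem s3 j = mem s2 j) \<and>
          (\<forall>c<K ^ l. mem s3 (m + c) = of_bool (gram_table \<sigma> x D K l b c))"
        have "table_ready l b s3" by (rule table_ready_modifies) (use 2 3 in auto)
        moreover have "?E s3" using 2 3 by (simp add: modifies_def)
        ultimately show "outp s3 = [] \<and>
            search_ready \<sigma> x D K l B (m - l * B) 0 (gram_table \<sigma> x D K l b) s3"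
          using prepared 3 by blast
      qed
    qed
  qed
qed

text \<open>For \<open>L \<ge> 1\<close>, the least \<open>B\<close> with
  \<open>12 * L * B > g\<close>: \<open>B\<close> disjoint pieces cannot all have
  \<open>12 * L\<close> wildcards.\<close>

definition gram_number :: "nat \<Rightarrow> nat" where
  "gram_number L = g div (12 * L) + 1"

text \<open>The condition \<open>4 * (16 * L * B) < 3 * m\<close>: the grams take less than three
  quarters of the pattern length, which leaves more than \<open>m / 4\<close> starting positions per
  window.\<close>

definition filtering :: "nat \<Rightarrow> bool" where
  "filtering L \<longleftrightarrow> 64 * L * gram_number L < 3 * m"

definition preprocessed :: "nat \<Rightarrow> state \<Rightarrow> bool" where
  "preprocessed L s \<longleftrightarrow> outp s = [] \<and>
    (if filtering L
     then search_ready \<sigma> x D K (16 * L) (gram_number L) (m - 16 * L * gram_number L) 0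
       (gram_table \<sigma> x D K (16 * L) (12 * L)) s
     else search_ready \<sigma> x D K 0 0 1 1 (\<lambda>_. False) s)"

lemma halts_preprocess:
  "halts w preprocess_prog (init_state w \<sigma> x) (\<lambda>s. \<exists>L. ceil_log \<sigma> m L \<and> preprocessed L s)"
proof -
  let ?s = "init_state w \<sigma> x"
  let ?Q = "\<lambda>s. \<exists>L. ceil_log \<sigma> m L \<and> preprocessed L s"
  have mw: "m < 2 ^ w" using m_power_less[of 1] by simp
  have w: "0 < w" using small_less[of 1] by (cases w) auto
  let ?E = "\<lambda>s. regs s rLen = 0 \<and> regs s rB = 0 \<and> regs s rH = 1 \<and> regs s rF0 = 1 \<and> outp s = []"
  let ?R1 = "\<lambda>s. ?E s \<and> regs s rM = m \<and> regs s rSig = \<sigma> \<and> regs s rOne = 1 \<and> regs s rC = 1 \<and>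
    (\<forall>j<m. mem s j = cell j)"
  have init: "halts w (block [Const rOne 1, Const rH 1, Const rF0 1, Binop Less rC rOne rM]) ?s ?R1"
    by (rule halts_block)
      (use w mw sigma m in \<open>simp_all add: init_state_def binop_eval take_bit_nat_eq_self pattern_cell_def\<close>)
  let ?params = "[Binop Div rD rSig rM, Binop Less rA rSig rM, Binop Add rD rD rA,
    Binop Div rK rSig rD, Binop Add rK rK rOne, Const rL 1, Mov rP rSig, Binop Less rC rP rM]"
  let ?R2 = "\<lambda>s. ready s \<and> ?E s \<and> regs s rL = 1 \<and> regs s rP = \<sigma> \<and> regs s rC = of_bool (\<sigma> < m)"
  have params: "halts w (block ?params) s ?R2" if "?R1 s" for s
  proof -
    have "K < 2 ^ w" using K_le m_power_less[of 3] by linarith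
    moreover have DK: "Suc (\<sigma> div D) = K" by (simp add: class_count_def)
    ultimately have K: "\<sigma> div D + 1 < 2 ^ w" by simp
    have "D \<le> \<sigma>"
      using sigma m by (auto simp: class_width_def not_less intro: le_trans[OF div_le_dividend])
    then have "\<sigma> div m + of_bool (\<sigma> < m) < 2 ^ w" using sigma by (simp add: class_width_def)
    then show ?thesis
      by (intro halts_block)
        (use that w K DK in \<open>simp_all add: ready_def binop_eval class_width_def[symmetric] take_bit_nat_eq_self\<close>)
  qed
  let ?R3 = "\<lambda>s. ready s \<and> ?E s \<and> ceil_log \<sigma> m (regs s rL)"
  let ?R4 = "\<lambda>s. ?R3 s \<and> regs s rj = m \<and> regs s rG = 0"
  let ?R5 = "\<lambda>s. ?R3 s \<and> regs s rG = g"
  let ?last = "[Const rA 12, Binop Mul rThr rA rL, Binop Div rV rG rThr, Binop Add rV rV rOne,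
    Const rA 16, Binop Mul rT rA rL, Binop Mul rQ rT rV, Const rA 4, Binop Mul rA rA rQ,
    Const rX 3, Binop Mul rX rX rM, Binop Less rC rA rX]"
  let ?R6 = "\<lambda>L s. ready s \<and> ?E s \<and> regs s rT = 16 * L \<and> regs s rV = gram_number L \<and>
    regs s rQ = 16 * L * gram_number L \<and> regs s rThr = 12 * L \<and> regs s rC = of_bool (filtering L)"
  have last: "halts w (block ?last) s (?R6 L)"
    if s: "ready s" "?E s" "regs s rL = L" "regs s rG = g" and L: "ceil_log \<sigma> m L" for s L
  proof -
    have "L \<le> m"
    proof (cases "1 < L")
      case True
      then have "\<sigma> ^ (L - 1) < m" using L by (simp add: ceil_log_def)
      moreover have "L - 1 < \<sigma> ^ (L - 1)" using sigma by (intro power_gt_expt) auto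
      ultimately show ?thesis by linarith
    qed (use m in simp)
    have "g \<le> m" by (rule count_le_length)
    then have B: "gram_number L \<le> m + 1"
      unfolding gram_number_def using div_le_dividend[of g "12 * L"] by linarith
    \<comment> \<open>As \<open>L \<le> m\<close> and \<open>B \<le> m + 1\<close>, the products of
      \<open>L\<close> and \<open>B\<close> formed by the block are at most
      \<open>64 * (m * (m + m))\<close>.\<close>
    have LB: "L * gram_number L \<le> m * (m + m)"
      using \<open>L \<le> m\<close> B m by (intro mult_mono) auto
    have "64 * (m * (m + m)) = 128 * m ^ 2" by (simp add: power2_eq_square)
    also have "\<dots> \<le> m ^ 7 * m ^ 2" using power_mono[of 2 m 7] m by (intro mult_le_mono1) simp
    also have "\<dots> = m ^ 9" by (simp flip: power_add)
    also have "\<dots> < 2 ^ w" by (rule m_power_less) simp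
    finally have 1: "64 * (m * (m + m)) < 2 ^ w" .
    have "64 * m \<le> m ^ 6 * m" using power_mono[of 2 m 6] m by (intro mult_le_mono1) simp
    also have "\<dots> = m ^ 7" by (simp flip: power_Suc2)
    also have "\<dots> < 2 ^ w" by (rule m_power_less) simp
    finally have 2: "64 * m < 2 ^ w" .
    have bd: "12 * L < 2 ^ w" "g div (12 * L) + 1 < 2 ^ w" "16 * L < 2 ^ w"
      "16 * L * gram_number L < 2 ^ w" "4 * (16 * L * gram_number L) < 2 ^ w" "3 * m < 2 ^ w"
      using 1 2 LB B \<open>L \<le> m\<close> m unfolding gram_number_def by linarith+
    have c: "(12 :: nat) < 2 ^ w" "(16 :: nat) < 2 ^ w" "(4 :: nat) < 2 ^ w" "(3 :: nat) < 2 ^ w"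
      by (rule small_less, simp)+
    have fl: "filtering L \<longleftrightarrow> 4 * (16 * L * gram_number L) < 3 * m"
      unfolding filtering_def by (simp add: mult.assoc)
    show ?thesis
      unfolding fl
      by (rule halts_block)
        (use s bd c in \<open>simp_all add: ready_def binop_eval take_bit_nat_eq_self gram_number_def\<close>)
  qed
  have finish: "halts w (Cond rC filter_prog (Instr (Mov rA rA))) s ?Q"
    if R: "?R6 L s" and L: "ceil_log \<sigma> m L" for s L
  proof (rule halts_Cond)
    assume "regs s rC \<noteq> 0"
    then have fl: "filtering L" using R by auto
    then have "16 * L * gram_number L \<le> m" unfolding filtering_def by linarith
    moreover have "1 \<le> L" using L by (simp add: ceil_log_def)
    ultimately have "halts w filter_prog s (\<lambda>s'. outp s' = [] \<and>
        search_ready \<sigma> x D K (16 * L) (gram_number L) (m - 16 * L * gram_number L) 0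
          (gram_table \<sigma> x D K (16 * L) (12 * L)) s')"
      using R table_fits[OF L] by (intro halts_filter) (auto simp: gram_number_def)
    then show "halts w filter_prog s ?Q"
      by (rule halts_mono) (use fl L in \<open>auto simp: preprocessed_def\<close>)
  next
    assume "regs s rC = 0"
    then have "\<not> filtering L" using R by auto
    then have "preprocessed L (step w [] (Mov rA rA) s)"
      using R by (simp add: preprocessed_def search_ready_def ready_def)
    then show "halts w (Instr (Mov rA rA)) s ?Q"
      using L by (intro halts_Instr) blast
  qed
  show ?thesis
    unfolding preprocess_prog_def
  \<comment> \<open>Three goals remain: the loop for \<open>L\<close>, the code after it, and the
    branch for \<open>m = 1\<close>, which \<open>rC = 1\<close> excludes here.\<close>
  proof (rule halts_Seq[OF init], rule halts_Cond, rule halts_Seq[OF params], assumption,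
      rule halts_Seq[where R = ?R3], goal_cases)
    case (1 s1 s2)
    then show ?case
      by (intro halts_mono[OF halts_ceil_log]) (auto simp: modifies_def ready_def)
  next
    case (2 s1 s2 s3)
    show ?case
    proof (rule halts_Seq[where R = ?R4])
      show "halts w (block [Mov rj rM, Const rG 0]) s3 ?R4"
        by (rule halts_block) (use 2(4) in \<open>simp_all add: ready_def binop_eval\<close>)
    next
      fix s4 assume 4: "?R4 s4"
      let ?count = "While rj (block [Binop Sub rj rj rOne, Load rA rj, Binop Eq rA rA rSig, Binop Add rG rG rA])"
      have count: "halts w ?count s4 ?R5"
        using 4 by (intro halts_mono[OF halts_count]) (auto simp: modifies_def ready_def)
      show "halts w (Seq ?count (Seq (block ?last) (Cond rC filter_prog (Instr (Mov rA rA))))) s4 ?Q"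
      proof (rule halts_Seq[OF count])
        fix s5 assume 5: "?R5 s5"
        then show "halts w (Seq (block ?last) (Cond rC filter_prog (Instr (Mov rA rA)))) s5 ?Q"
          by (intro halts_Seq[OF last finish]) auto
      qed
    qed
  next
    case (3 s1)
    then show ?case by simp
  qed
qed

end

text \<open>Kept apart because powers of \<open>m = 1\<close> bound nothing; the test
  \<open>1 < m\<close> fails and the initial parameters remain.\<close>

lemma halts_preprocess_singleton:
  assumes "length x = 1" "2 \<le> \<sigma>" "\<sigma> < 2 ^ w"
  shows "halts w preprocess_prog (init_state w \<sigma> x)
    (\<lambda>s. outp s = [] \<and> search_ready \<sigma> x 0 0 0 0 1 1 (\<lambda>_. False) s)"
proof -
  let ?Q = "\<lambda>s. outp s = [] \<and> search_ready \<sigma> x 0 0 0 0 1 1 (\<lambda>_. False) s"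
  have w: "0 < w" using assms by (cases w) auto
  have init: "halts w (block [Const rOne 1, Const rH 1, Const rF0 1, Binop Less rC rOne rM])
      (init_state w \<sigma> x) (\<lambda>s. regs s rC = 0 \<and> ?Q s)"
    by (rule halts_block)
      (use w assms in \<open>simp_all add: init_state_def search_ready_def binop_eval take_bit_nat_eq_self pattern_cell_def\<close>)
  show ?thesis
    unfolding preprocess_prog_def
    by (rule halts_Seq[OF init], rule halts_Cond, simp, rule halts_Instr)
      (simp add: search_ready_def binop_eval)
qed


section \<open>The lower bound for fixed algorithms\<close>

lemma occurs_at_nth:
  "occurs_at x u j \<longleftrightarrow> j + length x \<le> length u \<and>
    (\<forall>i<length x. x ! i = None \<or> x ! i = Some (u ! (j + i)))"
  unfolding occurs_at_def matches_def corresp_def by (auto simp: list_all2_conv_all_nth)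

lemma textsI: "length u = n \<Longrightarrow> (\<And>i. i < n \<Longrightarrow> u ! i < \<sigma>) \<Longrightarrow> u \<in> texts \<sigma> n"
  unfolding texts_def by (auto simp: in_set_conv_nth)

lemma patterns_letter:
  assumes "x \<in> patterns \<sigma> m g" "i < m" "x ! i = Some a"
  shows "a < \<sigma>"
proof -
  have "Some a \<in> set x" using assms by (metis (mono_tags) mem_Collect_eq nth_mem patterns_def)
  then show ?thesis using assms(1) unfolding patterns_def by auto
qed

text \<open>Two texts agree with \<open>u\<close> on all probed positions, one with and one without
  an occurrence at \<open>j\<close>; a sound verdict that sees only these probes cannot be right
  about both.\<close>

lemma not_decided:
  assumes alg: "fixed_algorithm \<sigma> m g \<pi> V" and sigma: "2 \<le> \<sigma>"
    and x: "x \<in> patterns \<sigma> m g" and h: "h \<in> lists {..<\<sigma>}" and u: "u \<in> texts \<sigma> (2 * m)"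
    and j: "j \<le> m" and k: "k \<le> 2 * m"
    and consistent: "\<And>i. i < m \<Longrightarrow> i + j \<in> set (take k \<pi>) \<Longrightarrow> x ! i = None \<or> x ! i = Some (u ! (i + j))"
    and unread: "i < m" "x ! i \<noteq> None" "i + j \<notin> set (take k \<pi>)"
  shows "\<not> decided \<pi> V x h u k j"
proof
  assume "decided \<pi> V x h u k j"
  then obtain l v where l: "l \<le> k" "V x h (chars_read \<pi> u l) j = Some v"
    unfolding decided_def by auto
  define R where "R = set (take k \<pi>)"
  have len: "length x = m" "length u = 2 * m" using x u by (auto simp: patterns_def texts_def)
  obtain a where a: "x ! i = Some a" using unread by auto
  define fill where "fill f = map (\<lambda>p. if p \<in> R then u ! p else f p) [0..<2 * m]" for f :: "nat \<Rightarrow> nat"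
  \<comment> \<open>\<open>f1\<close> completes the probed characters to an occurrence, with 0 where
    any letter will do; \<open>f2\<close> spoils it at the unread letter, using a second letter of
    the alphabet.\<close>
  define f1 where "f1 p = (if j \<le> p \<and> p < j + m then (case x ! (p - j) of None \<Rightarrow> 0 | Some b \<Rightarrow> b) else 0)" for p
  define f2 where "f2 p = (if p = i + j then (if a = 0 then 1 else 0) else f1 p)" for p
  have f1: "f1 p < \<sigma>" if "p < 2 * m" for p
    using patterns_letter[OF x, of "p - j"] sigma unfolding f1_def
    by (auto split: option.splits)
  then have f2: "f2 p < \<sigma>" if "p < 2 * m" for p
    using that sigma unfolding f2_def by auto
  have texts: "fill f \<in> texts \<sigma> (2 * m)" if "\<And>p. p < 2 * m \<Longrightarrow> f p < \<sigma>" for f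
    using that texts_nth_less[OF u] by (intro textsI) (auto simp: fill_def)
  have "set \<pi> = {..<2 * m}" using alg unfolding fixed_algorithm_def by blast
  then have read: "chars_read \<pi> (fill f) l = chars_read \<pi> u l" for f
    using l(1) set_take_subset_set_take[of l k \<pi>] set_take_subset[of l \<pi>]
    unfolding chars_read_def fill_def R_def by (auto simp: subset_iff)
  have verdict: "v = occurs_at x (fill f) j" if "\<And>p. p < 2 * m \<Longrightarrow> f p < \<sigma>" for f
  proof -
    have "\<forall>k\<le>2 * m. \<forall>v. V x h (chars_read \<pi> (fill f) k) j = Some v \<longrightarrow> v = occurs_at x (fill f) j"
      using alg x h texts[OF that] j unfolding fixed_algorithm_def by simp
    moreover have "l \<le> 2 * m" using l(1) k by linarith
    ultimately show ?thesis using l(2) read by simp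
  qed
  have "occurs_at x (fill f1) j"
    unfolding occurs_at_nth len
  proof (intro conjI allI impI)
    fix i' assume i': "i' < m"
    then show "x ! i' = None \<or> x ! i' = Some (fill f1 ! (j + i'))"
      using consistent[OF i'] j by (cases "x ! i'") (auto simp: fill_def f1_def R_def add.commute)
  qed (use j in \<open>simp add: fill_def\<close>)
  moreover have "fill f2 ! (j + i) \<noteq> a"
    using unread j by (auto simp: fill_def f2_def R_def add.commute)
  then have "\<not> occurs_at x (fill f2) j"
    unfolding occurs_at_nth len using unread a by auto
  ultimately show False
    using verdict[OF f1] verdict[OF f2] by simp
qed

text \<open>Decisions persist as more characters are read, so a position undecided after
  \<open>k\<close> probes puts the least sufficient number above \<open>k\<close>.\<close>

lemma block_inspections_ge:
  assumes alg: "fixed_algorithm \<sigma> m g \<pi> V" and x: "x \<in> patterns \<sigma> m g"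
    and h: "h \<in> lists {..<\<sigma>}" and u: "u \<in> texts \<sigma> (2 * m)"
    and j: "j \<le> m" "\<not> decided \<pi> V x h u k j"
  shows "k + 1 \<le> block_inspections m \<pi> V x h u"
proof -
  define b where "b = block_inspections m \<pi> V x h u"
  have "\<forall>j\<le>m. decided \<pi> V x h u (2 * m) j"
    using alg x h u unfolding fixed_algorithm_def by blast
  then have "\<forall>j\<le>m. decided \<pi> V x h u b j"
    unfolding b_def block_inspections_def by (rule LeastI)
  then have "decided \<pi> V x h u b j" using j by blast
  then have "\<not> b \<le> k" using j(2) unfolding decided_def by (meson le_trans)
  then show ?thesis unfolding b_def by simp
qed

lemma set_random_text:
  assumes "0 < \<sigma>"
  shows "set_pmf (random_text \<sigma> n) = texts \<sigma> n" and "finite (texts \<sigma> n)"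
proof -
  show "set_pmf (random_text \<sigma> n) = texts \<sigma> n"
    using assms by (auto simp: random_text_def texts_def set_replicate_pmf set_pmf_of_set lessThan_empty_iff)
  show "finite (texts \<sigma> n)"
    unfolding texts_def using finite_lists_length_eq[of "{..<\<sigma>}" n] by (simp add: conj_commute)
qed

text \<open>The number of probes is forced in every block of every text, so the expectation is
  compared with that of a constant.\<close>

lemma avg_inspections_ge:
  assumes alg: "fixed_algorithm \<sigma> m g \<pi> V" and sigma: "2 \<le> \<sigma>" and x: "x \<in> patterns \<sigma> m g"
    and undecided: "\<And>h u. h \<in> lists {..<\<sigma>} \<Longrightarrow> u \<in> texts \<sigma> (2 * m) \<Longrightarrow>
      \<exists>j\<le>m. \<not> decided \<pi> V x h u k j"
  shows "real ((n div (2 * m)) * (k + 1)) \<le> avg_inspections \<sigma> m \<pi> V x n"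
proof -
  have ge: "real ((n div (2 * m)) * (k + 1)) \<le> real (inspections m \<pi> V x t)" if t: "t \<in> texts \<sigma> n" for t
  proof -
    have "k + 1 \<le> block_inspections m \<pi> V x (take (2 * m * b) t) (take (2 * m) (drop (2 * m * b) t))"
      if b: "b < length t div (2 * m)" for b
    proof -
      have "Suc b * (2 * m) \<le> length t"
        using b by (metis Suc_leI div_times_less_eq_dividend le_trans mult_le_mono1)
      then have u: "take (2 * m) (drop (2 * m * b) t) \<in> texts \<sigma> (2 * m)"
        using t unfolding texts_def by (auto simp: algebra_simps dest!: in_set_takeD in_set_dropD)
      have h: "take (2 * m * b) t \<in> lists {..<\<sigma>}"
        using t unfolding texts_def by (auto dest!: in_set_takeD)
      show ?thesis
        using undecided[OF h u] block_inspections_ge[OF alg x h u] by blast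
    qed
    then have "(\<Sum>b<length t div (2 * m). k + 1) \<le> inspections m \<pi> V x t"
      unfolding inspections_def by (intro sum_mono) auto
    then have "(n div (2 * m)) * (k + 1) \<le> inspections m \<pi> V x t"
      using t by (simp add: texts_def)
    then show ?thesis by (simp only: of_nat_le_iff)
  qed
  have "measure_pmf.expectation (random_text \<sigma> n) (\<lambda>_. real ((n div (2 * m)) * (k + 1)))
      \<le> avg_inspections \<sigma> m \<pi> V x n"
    unfolding avg_inspections_def
    using set_random_text[of \<sigma> n] sigma ge
    by (intro integral_mono_AE) (auto intro!: integrable_measure_pmf_finite simp: AE_measure_pmf_iff)
  then show ?thesis by simp
qed

section \<open>Adversarial patterns\<close>

lemma count_None_map:
  assumes "S \<subseteq> {..<m}"
  shows "count_list (map (\<lambda>i. if i \<in> S then None else Some (y i)) [0..<m]) None = card S"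
proof -
  have "count_list (map (\<lambda>i. if i \<in> S then None else Some (y i)) [0..<m]) None =
      length (filter (\<lambda>i. i \<in> S) [0..<m])"
    by (simp add: count_list_eq_length_filter filter_map o_def cong: filter_cong)
  also have "\<dots> = card {i. i < m \<and> i \<in> S}"
    by (simp add: length_filter_conv_card cong: conj_cong)
  also have "{i. i < m \<and> i \<in> S} = S" using assms by auto
  finally show ?thesis .
qed

text \<open>Applied to probes: those of the first \<open>g\<close> that fall into the factor are
  among the first \<open>g\<close> probes of the factor.\<close>

lemma filter_take_subset: "set (filter P (take n xs)) \<subseteq> set (take n (filter P xs))"
proof (induction xs arbitrary: n)
  case (Cons a xs)
  show ?case
  proof (cases n)
    case (Suc n')
    have "set (take n' (filter P xs)) \<subseteq> set (take n (filter P xs))"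
      using Suc by (intro set_take_subset_set_take) simp
    then show ?thesis using Cons[of n'] Suc by auto
  qed simp
qed simp

text \<open>The adversarial pattern has its wildcards at the first \<open>g\<close> probed positions of the factor at
  offset \<open>0\<close>.\<close>

lemma wildcard_lower_bound:
  assumes alg: "fixed_algorithm \<sigma> m g \<pi> V" and sigma: "2 \<le> \<sigma>" and g: "g < m"
  shows "\<exists>x\<in>patterns \<sigma> m g. real ((n div (2 * m)) * (g + 1)) \<le> avg_inspections \<sigma> m \<pi> V x n"
proof -
  have \<pi>: "distinct \<pi>" "set \<pi> = {..<2 * m}" using alg unfolding fixed_algorithm_def by blast+
  \<comment> \<open>The positions of the factor at offset 0, in the order in which they are
    probed.\<close>
  define ys where "ys = filter (\<lambda>p. p < m) \<pi>"
  have ys: "distinct ys" "set ys = {..<m}"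
    unfolding ys_def set_filter \<pi>(2) by (rule distinct_filter[OF \<pi>(1)]) auto
  have len: "length ys = m" using distinct_card[OF ys(1)] unfolding ys(2) card_lessThan by (rule sym)
  define S where "S = set (take g ys)"
  define x :: "nat option list" where "x = map (\<lambda>i. if i \<in> S then None else Some 0) [0..<m]"
  have S: "S \<subseteq> {..<m}" unfolding S_def ys(2)[symmetric] by (rule set_take_subset)
  have "card S = length (take g ys)"
    unfolding S_def by (rule distinct_card[OF distinct_take[OF ys(1)]])
  then have card_S: "card S = g" using len g by simp
  have read: "i \<in> S" if "i \<in> set (take g \<pi>)" "i < m" for i
    using filter_take_subset[of "\<lambda>p. p < m" g \<pi>] that by (auto simp: S_def ys_def)
  \<comment> \<open>The position of the factor that is probed next after its \<open>g\<close>
    wildcards carries a letter, and the first \<open>g\<close> probes do not reach it.\<close>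
  have "ys ! g \<notin> S"
    using ys(1) len g by (auto simp: S_def in_set_conv_nth nth_eq_iff_index_eq)
  moreover have "ys ! g < m" using ys(2) nth_mem[of g ys] len g by blast
  ultimately have free: "ys ! g < m" "x ! (ys ! g) \<noteq> None" "ys ! g + 0 \<notin> set (take g \<pi>)"
    using read by (auto simp: x_def)
  have x: "x \<in> patterns \<sigma> m g"
    using sigma count_None_map[OF S, of "\<lambda>_. 0"] card_S by (auto simp: patterns_def x_def)
  have "\<exists>j\<le>m. \<not> decided \<pi> V x h u g j" if "h \<in> lists {..<\<sigma>}" "u \<in> texts \<sigma> (2 * m)" for h u
  proof -
    have "\<not> decided \<pi> V x h u g 0"
    proof (rule not_decided[OF alg sigma x that _ _ _ free])
      fix i assume "i < m" "i + 0 \<in> set (take g \<pi>)"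
      then show "x ! i = None \<or> x ! i = Some (u ! (i + 0))" using read by (simp add: x_def)
    qed (use g in simp_all)
    then show ?thesis by blast
  qed
  then show ?thesis using avg_inspections_ge[OF alg sigma x] x by blast
qed

text \<open>The second condition says that the sets \<open>Q - J a\<close> are pairwise disjoint,
  written without subtraction. The offsets are chosen greedily: earlier ones exclude at most
  \<open>card A * (card Q * card Q)\<close> of the \<open>m + 1\<close> candidates.\<close>

lemma separated_translates:
  fixes Q :: "nat set"
  assumes "finite A" "finite Q" "card A * (card Q * card Q) \<le> m"
  shows "\<exists>J. (\<forall>a\<in>A. J a \<le> m) \<and>
    (\<forall>a\<in>A. \<forall>b\<in>A. \<forall>p\<in>Q. \<forall>q\<in>Q. p + J b = q + J a \<longrightarrow> a = b)"
  using assms(1,3)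
proof (induction A)
  case (insert a A)
  then obtain J where J: "\<forall>a\<in>A. J a \<le> m"
    "\<forall>a\<in>A. \<forall>b\<in>A. \<forall>p\<in>Q. \<forall>q\<in>Q. p + J b = q + J a \<longrightarrow> a = b" by auto
  define F where "F = (\<lambda>(b, p, q). J b + p - q) ` (A \<times> Q \<times> Q)"
  have "finite F" unfolding F_def using insert(1) assms(2) by auto
  have "card F \<le> card (A \<times> Q \<times> Q)"
    unfolding F_def using insert(1) assms(2) by (intro card_image_le) auto
  also have "\<dots> \<le> m" using insert by (simp add: card_cartesian_product)
  finally have "card F < card {..m}" by simp
  then have "\<not> {..m} \<subseteq> F" using card_mono[OF \<open>finite F\<close>, of "{..m}"] by linarith
  then obtain j where j: "j \<le> m" "j \<notin> F" by auto
  have *: "q + j \<noteq> p + J b" if "b \<in> A" "p \<in> Q" "q \<in> Q" for b p q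
  proof
    assume "q + j = p + J b"
    then have "j = J b + p - q" by simp
    then have "j \<in> F" unfolding F_def using that by (intro image_eqI[of _ _ "(b, p, q)"]) auto
    then show False using j by simp
  qed
  have "\<forall>b\<in>insert a A. (J(a := j)) b \<le> m" using J j by auto
  moreover have "c = b" if "c \<in> insert a A" "b \<in> insert a A" "p \<in> Q" "q \<in> Q"
    "p + (J(a := j)) b = q + (J(a := j)) c" for c b p q
  proof (cases "b = a")
    case True
    then show ?thesis using that *[of c q p] by (cases "c = a") auto
  next
    case b: False
    show ?thesis
    proof (cases "c = a")
      case True
      then show ?thesis using that b *[of b p q] by auto
    next
      case False
      then show ?thesis using that b J(2) by auto
    qed
  qed
  ultimately show ?case by blast
qed simp

text \<open>The adversarial pattern contains, for each of the \<open>\<sigma> ^ k\<close> possible contents of the first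
  \<open>k\<close> probes, a translate of the probe set with that content, so that the first \<open>k\<close> probes never
  suffice.\<close>

lemma logarithmic_lower_bound:
  assumes alg: "fixed_algorithm \<sigma> m g \<pi> V" and sigma: "2 \<le> \<sigma>"
    and k: "\<sigma> ^ k * (k * k) \<le> m" "k + g < m"
  shows "\<exists>x\<in>patterns \<sigma> m g. real ((n div (2 * m)) * (k + 1)) \<le> avg_inspections \<sigma> m \<pi> V x n"
proof -
  have \<pi>: "distinct \<pi>" "set \<pi> = {..<2 * m}" using alg unfolding fixed_algorithm_def by blast+
  have "length \<pi> = 2 * m" using distinct_card[OF \<pi>(1)] unfolding \<pi>(2) card_lessThan by (rule sym)
  define Q where "Q = take k \<pi>"
  have Q: "length Q = k" "distinct Q" "card (set Q) = k"
    using \<pi> \<open>length \<pi> = 2 * m\<close> k(2) distinct_card[of Q] by (auto simp: Q_def)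
  define C where "C = texts \<sigma> k"
  have C: "C = {c. set c \<subseteq> {..<\<sigma>} \<and> length c = k}" by (auto simp: C_def texts_def)
  have "finite C" "card C = \<sigma> ^ k"
    unfolding C using card_lists_length_eq[of "{..<\<sigma>}" k] finite_lists_length_eq[of "{..<\<sigma>}" k]
    by auto
  then obtain J where J01: "\<forall>c\<in>C. J c \<le> m"
    and J02: "\<forall>c\<in>C. \<forall>d\<in>C. \<forall>p\<in>set Q. \<forall>q\<in>set Q. p + J d = q + J c \<longrightarrow> c = d"
    using separated_translates[of C "set Q" m] k(1) Q by auto
  have J: "J c \<le> m" if "c \<in> C" for c
    using J01 that by blast
  have J': "c = d" if "c \<in> C" "d \<in> C" "p \<in> set Q" "q \<in> set Q" "p + J d = q + J c" for c d p q
    using J02 that by blast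
  \<comment> \<open>\<open>is_letter i a\<close> prescribes the letter \<open>a\<close> at pattern
    position \<open>i\<close>, so that the pattern placed at \<open>J c\<close> agrees with the
    content \<open>c\<close> under all its probes. Separation makes the prescriptions
    consistent.\<close>
  define is_letter where
    "is_letter i a \<longleftrightarrow> (\<exists>c\<in>C. \<exists>s<k. Q ! s = i + J c \<and> a = c ! s)" for i a
  have unique: "a = b" if "is_letter i a" "is_letter i b" for i a b
  proof -
    obtain c s d r where cs: "c \<in> C" "s < k" "Q ! s = i + J c" "a = c ! s"
      "d \<in> C" "r < k" "Q ! r = i + J d" "b = d ! r"
      using \<open>is_letter i a\<close> \<open>is_letter i b\<close> unfolding is_letter_def by auto
    have "Q ! s \<in> set Q" "Q ! r \<in> set Q" using cs(2,6) Q(1) by simp_all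
    moreover have "Q ! s + J d = Q ! r + J c" using cs by simp
    ultimately have "c = d" using J' cs(1,5) by blast
    moreover from this have "Q ! s = Q ! r" using cs(3,7) by simp
    then have "s = r" using nth_eq_iff_index_eq[OF Q(2)] cs(2,6) Q(1) by blast
    ultimately show "a = b" using cs by simp
  qed
  define y where "y i = (if \<exists>a. is_letter i a then SOME a. is_letter i a else 0)" for i
  have y: "y i = a" if "is_letter i a" for i a
  proof -
    have "is_letter i (SOME a. is_letter i a)" using that by (rule someI)
    then show ?thesis using unique[OF _ that] that unfolding y_def by auto
  qed
  have y_less: "y i < \<sigma>" for i
  proof (cases "\<exists>a. is_letter i a")
    case True
    then obtain a where a: "is_letter i a" by blast
    then have "a < \<sigma>" unfolding is_letter_def C by (auto dest!: nth_mem)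
    then show ?thesis using y[OF a] by simp
  qed (use sigma in \<open>simp add: y_def\<close>)
  \<comment> \<open>The wildcards at the first \<open>g\<close> positions may overwrite prescribed
    letters, since a wildcard agrees with every character.\<close>
  define x where "x = map (\<lambda>i. if i \<in> {..<g} then None else Some (y i)) [0..<m]"
  have x: "x \<in> patterns \<sigma> m g"
    using y_less count_None_map[of "{..<g}" m y] k(2) by (auto simp: patterns_def x_def)
  have "\<exists>j\<le>m. \<not> decided \<pi> V x h u k j" if h: "h \<in> lists {..<\<sigma>}" and u: "u \<in> texts \<sigma> (2 * m)" for h u
  proof -
    define c where "c = map (\<lambda>p. u ! p) Q"
    have "set Q \<subseteq> {..<2 * m}" using \<pi>(2) set_take_subset[of k \<pi>] by (auto simp: Q_def)
    then have c: "c \<in> C" using u Q(1) unfolding C c_def texts_def by (auto simp: subset_iff)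
    \<comment> \<open>The pattern placed at \<open>J c\<close> has \<open>m - g > k\<close> letters,
      so \<open>k\<close> probes cannot read all of them.\<close>
    have "card {g + J c..<m + J c} = m - g" by simp
    then have "\<not> {g + J c..<m + J c} \<subseteq> set Q"
      using card_mono[of "set Q" "{g + J c..<m + J c}"] Q k(2) by auto
    then obtain p where p: "g + J c \<le> p" "p < m + J c" "p \<notin> set Q"
      by (meson atLeastLessThan_iff subsetI)
    have "\<not> decided \<pi> V x h u k (J c)"
    proof (rule not_decided[OF alg sigma x h u J[OF c], where i = "p - J c"])
      fix i assume i: "i < m" "i + J c \<in> set (take k \<pi>)"
      then obtain s where s: "s < k" "Q ! s = i + J c"
        using Q by (auto simp: Q_def[symmetric] in_set_conv_nth)
      then have "is_letter i (u ! (i + J c))"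
        unfolding is_letter_def using c Q s by (intro bexI[of _ c] exI[of _ s]) (auto simp: c_def)
      then show "x ! i = None \<or> x ! i = Some (u ! (i + J c))"
        using y i(1) by (simp add: x_def)
    qed (use p k(2) in \<open>auto simp: Q_def x_def\<close>)
    then show ?thesis using J[OF c] by blast
  qed
  then show ?thesis using avg_inspections_ge[OF alg sigma x] x by blast
qed

theorem fixed_algorithm_lower_bound:
  assumes sigma: "2 \<le> \<sigma>" and g: "g < m" and n: "2 * m \<le> n" and alg: "fixed_algorithm \<sigma> m g \<pi> V"
  shows "\<exists>x\<in>patterns \<sigma> m g. 1 / 24 * cost_bound \<sigma> m g n \<le> avg_inspections \<sigma> m \<pi> V x n"
proof -
  define N where "N = n div (2 * m)"
  define ell where "ell = log (real \<sigma>) (real m)"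
  have "n < (N + 1) * (2 * m)"
    unfolding N_def using g by (simp add: dividend_less_div_times)
  have "1 \<le> N" unfolding N_def using n g by (simp add: div_greater_zero_iff Suc_leI)
  then have "m \<le> N * m" by simp
  moreover have "(N + 1) * (2 * m) = 2 * (N * m) + 2 * m" by (simp add: algebra_simps)
  moreover have "N * (4 * m) = 4 * (N * m)" by simp
  ultimately have "n \<le> N * (4 * m)" using \<open>n < (N + 1) * (2 * m)\<close> by linarith
  then have "real n \<le> real (N * (4 * m))" by (simp only: of_nat_le_iff)
  then have N: "real n / real m \<le> 4 * real N"
    using g by (simp add: field_simps)
  \<comment> \<open>24 is 4 * 6: the 4 compares \<open>n / m\<close> with the number of complete
    blocks, the 6 compares \<open>g\<close> plus the logarithm with the number of forced
    probes.\<close>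
  have *: "1 / 24 * cost_bound \<sigma> m g n \<le> real (N * (k + 1))"
    if "real g + max 1 ell \<le> 6 * (real k + 1)" for k
  proof -
    have "cost_bound \<sigma> m g n = real n / real m * (real g + max 1 ell)"
      by (simp add: cost_bound_def ell_def)
    also have "\<dots> \<le> (4 * real N) * (6 * (real k + 1))"
      using N that by (intro mult_mono) auto
    finally show ?thesis by (simp add: algebra_simps)
  qed
  show ?thesis
  \<comment> \<open>The wildcards dominate in the first case, the logarithm in the second.\<close>
  proof (cases "ell \<le> real g + 1")
    case True
    then have "real g + max 1 ell \<le> 6 * (real g + 1)" by auto
    then show ?thesis
      using *[of g] wildcard_lower_bound[OF alg sigma g, of n] unfolding N_def by (meson order_trans)
  next
    case False
    \<comment> \<open>A third of the logarithm leaves room for the factor \<open>k * k\<close>,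
      since \<open>k \<le> \<sigma> ^ k\<close> and
      \<open>\<sigma> ^ (3 * k) \<le> m\<close>.\<close>
    define k where "k = nat \<lfloor>ell / 3\<rfloor>"
    have kl: "real k \<le> ell / 3" "ell / 3 \<le> real k + 1"
      using False unfolding k_def by linarith+
    have m_eq: "real \<sigma> powr ell = real m" using sigma g by (simp add: ell_def)
    have le_m: "\<sigma> ^ a \<le> m" if "real a \<le> ell" for a
    proof -
      have "real (\<sigma> ^ a) = real \<sigma> powr real a" using sigma by (simp add: powr_realpow)
      also have "\<dots> \<le> real \<sigma> powr ell" using that sigma by (intro powr_mono) auto
      finally show ?thesis unfolding m_eq by (simp only: of_nat_le_iff)
    qed
    have pow: "2 ^ a \<le> \<sigma> ^ a" for a using sigma by (intro power_mono) auto
    have k3: "\<sigma> ^ (3 * k) \<le> m" using kl by (intro le_m) simp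
    have "k \<le> \<sigma> ^ k" using pow[of k] less_exp[of k] by linarith
    then have "\<sigma> ^ k * (k * k) \<le> \<sigma> ^ k * (\<sigma> ^ k * \<sigma> ^ k)" by (intro mult_mono) auto
    also have "\<dots> = \<sigma> ^ (3 * k)" by (simp add: numeral_3_eq_3 power_add)
    finally have 1: "\<sigma> ^ k * (k * k) \<le> m" using k3 by linarith
    have "\<sigma> ^ (g + 1) \<le> m" using False by (intro le_m) auto
    moreover have "2 * (g + 1) \<le> 2 ^ (g + 1)"
      using mult_le_mono2[OF Suc_leI[OF less_exp[of g]], of 2] by simp
    ultimately have "2 * (g + 1) \<le> m" using pow[of "g + 1"] by linarith
    moreover have "3 * k < m" using k3 pow[of "3 * k"] less_exp[of "3 * k"] by linarith
    \<comment> \<open>\<open>g\<close> is below one half and \<open>k\<close> below one third of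
      \<open>m\<close>.\<close>
    ultimately have 2: "k + g < m" by presburger
    have "max 1 ell = ell" using False by auto
    then have "real g + max 1 ell \<le> 6 * (real k + 1)" using False kl by argo
    then show ?thesis
      using *[of k] logarithmic_lower_bound[OF alg sigma 1 2, of n] unfolding N_def
      by (meson order_trans)
  qed
qed


section \<open>The probability of a verification\<close>

lemma prepared_naive:
  assumes "set x \<subseteq> insert None (Some ` {..<\<sigma>})" "\<sigma> < 2 ^ w" "1 \<le> length x"
  shows "prepared w \<sigma> x D K 0 0 1 1 table"
  using assms by unfold_locales auto

text \<open>Independence of the characters, for events that constrain each position
  separately.\<close>

lemma prob_replicate_pmf:
  fixes p :: "nat pmf"
  shows "measure_pmf.prob (replicate_pmf n p) {t. length t = n \<and> (\<forall>j<n. t ! j \<in> S j)} =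
    (\<Prod>j<n. measure_pmf.prob p (S j))"
proof (induction n arbitrary: S)
  case 0
  then show ?case by simp
next
  case (Suc n)
  let ?E = "\<lambda>n S. {t :: nat list. length t = n \<and> (\<forall>j<n. t ! j \<in> S j)}"
  have "replicate_pmf (Suc n) p = map_pmf (\<lambda>(a, t). a # t) (pair_pmf p (replicate_pmf n p))"
    by (simp add: pair_pmf_def map_bind_pmf)
  moreover have "(\<lambda>(a, t). a # t) -` ?E (Suc n) S = S 0 \<times> ?E n (\<lambda>j. S (Suc j))"
    by (auto simp: nth_Cons less_Suc_eq_0_disj split: nat.splits)
  ultimately have "measure_pmf.prob (replicate_pmf (Suc n) p) (?E (Suc n) S) =
      measure_pmf.prob (pair_pmf p (replicate_pmf n p)) (S 0 \<times> ?E n (\<lambda>j. S (Suc j)))"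
    by (simp only: measure_map_pmf)
  also have "\<dots> = measure_pmf.prob p (S 0) * (\<Prod>j<n. measure_pmf.prob p (S (Suc j)))"
    using Suc[of "\<lambda>j. S (Suc j)"] by (simp add: measure_pmf_prob_product)
  also have "\<dots> = (\<Prod>j<Suc n. measure_pmf.prob p (S j))"
    by (simp only: prod.lessThan_Suc_shift)
  finally show ?case .
qed

lemma prob_class_le:
  assumes "0 < \<sigma>" "0 < D"
  shows "measure_pmf.prob (pmf_of_set {..<\<sigma>}) {a. a div D = c} \<le> real D / real \<sigma>"
proof -
  have "{..<\<sigma>} \<inter> {a. a div D = c} \<subseteq> {c * D..<c * D + D}"
    using dividend_less_times_div[OF assms(2)] by (auto simp: algebra_simps)
  then have "card ({..<\<sigma>} \<inter> {a. a div D = c}) \<le> D"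
    using card_mono[of "{c * D..<c * D + D}"] by fastforce
  then show ?thesis
    using assms(1) by (simp add: measure_pmf_of_set lessThan_empty_iff divide_right_mono)
qed

context preprocessing
begin

section \<open>Soundness of the filter\<close>

lemma D_le: "D \<le> \<sigma>"
  using sigma m by (auto simp: class_width_def not_less intro: le_trans[OF div_le_dividend])

lemma class_less: "a < \<sigma> \<Longrightarrow> a div D < K"
  unfolding class_count_def using div_le_mono[of a \<sigma> D] by simp

text \<open>For an occurrence at \<open>i\<close> the grams of the window face \<open>B\<close>
  disjoint pieces of the pattern, from offset \<open>d = r + h - 1 - i\<close> on. Not all pieces
  can have \<open>12 * L\<close> of the \<open>g\<close> wildcards, and a piece with fewer puts its
  gram into the table.\<close>

lemma window_step:
  assumes L: "ceil_log \<sigma> m L" and filtering: "filtering L"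
    and t: "t \<in> texts \<sigma> n" and i: "r \<le> i" "i < r + (m - 16 * L * gram_number L)"
    and occ: "occurs_at x t i"
  shows "\<exists>b<gram_number L. gram_table \<sigma> x D K (16 * L) (12 * L)
    (gram_code D K t (r + (m - 16 * L * gram_number L) - 1 + b * (16 * L)) (16 * L))"
proof -
  define l B where "l = 16 * L" and "B = gram_number L"
  define h where "h = m - l * B"
  define d where "d = r + h - 1 - i"
  have "l * B < m" using filtering unfolding filtering_def l_def B_def by linarith
  then have h: "1 \<le> h" "B * l + h = m" unfolding h_def by (simp_all add: mult.commute)
  have d: "r + h - 1 = i + d" "d < h" using i unfolding d_def h_def l_def B_def by linarith+
  let ?wild = "\<lambda>j. of_bool (x ! j = None) :: nat"
  have "\<exists>b<B. wildcards x (d + b * l) l < 12 * L"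
  proof (rule ccontr)
    have block_sum: "wildcards x (d + b * l) l = (\<Sum>j = b * l..<b * l + l. ?wild (d + j))" for b
      unfolding wildcards_def
      using sum.shift_bounds_nat_ivl[of "\<lambda>j. ?wild (d + j)" 0 "b * l" l]
      by (simp add: lessThan_atLeast0 algebra_simps)
    assume "\<not> ?thesis"
    then have "(\<Sum>b<B. 12 * L) \<le> (\<Sum>b<B. wildcards x (d + b * l) l)"
      by (intro sum_mono) (meson lessThan_iff not_le)
    also have "\<dots> = (\<Sum>b<B. \<Sum>j = b * l..<b * l + l. ?wild (d + j))"
      by (simp only: block_sum)
    also have "(\<Sum>b<B. \<Sum>j = b * l..<b * l + l. ?wild (d + j)) = (\<Sum>j<B * l. ?wild (d + j))"
      by (rule sum.nat_group)
    also have "\<dots> = (\<Sum>j = d..<d + B * l. ?wild j)"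
      using sum.shift_bounds_nat_ivl[of ?wild 0 d "B * l"]
      by (simp add: lessThan_atLeast0 algebra_simps)
    also have "\<dots> \<le> (\<Sum>j<m. ?wild j)"
      using h d(2) by (intro sum_mono2) auto
    also have "\<dots> = g" using wildcards_all[of x] by (simp add: wildcards_def)
    finally have "B * (12 * L) \<le> g" by simp
    moreover have "g < B * (12 * L)"
      using L unfolding B_def gram_number_def ceil_log_def
      using dividend_less_div_times[of "12 * L" g] by simp
    ultimately show False by simp
  qed
  then obtain b where b: "b < B" "wildcards x (d + b * l) l < 12 * L" by blast
  let ?o = "d + b * l"
  have "Suc b * l \<le> B * l" using b(1) by (intro mult_le_mono1) simp
  \<comment> \<open>\<open>d < h\<close> makes this inequality strict, as \<open>gram_table\<close>
    demands.\<close>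
  then have o: "?o + l < m" using h d(2) by simp
  have xt: "i + m \<le> n" "\<forall>j<m. cell j = \<sigma> \<or> cell j = t ! (i + j)"
    using occ occurs_at_iff[OF x, of t i] t unfolding texts_def by auto
  have "gram_match \<sigma> x D K ?o l (gram_code D K t (i + ?o) l) \<longleftrightarrow>
    (\<forall>j<l. cell (?o + j) = \<sigma> \<or> cell (?o + j) div D = (t ! (i + ?o + j)) div D)"
    by (rule gram_match_code, rule class_less, rule texts_nth_less[OF t]) (use o xt(1) in linarith)
  also have "\<dots>"
  proof (intro allI impI)
    fix j assume "j < l"
    then have "?o + j < m" using o by linarith
    then have "cell (?o + j) = \<sigma> \<or> cell (?o + j) = t ! (i + (?o + j))" using xt(2) by blast
    then show "cell (?o + j) = \<sigma> \<or> cell (?o + j) div D = (t ! (i + ?o + j)) div D"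
      by (auto simp: add.assoc)
  qed
  finally have "gram_table \<sigma> x D K l (12 * L) (gram_code D K t (i + ?o) l)"
    unfolding gram_table_def using b o by (intro exI[of _ ?o]) auto
  moreover have "i + ?o = r + h - 1 + b * l" using d(1) by simp
  ultimately show ?thesis using b(1) unfolding h_def l_def B_def by auto
qed

lemma prepared_filtering:
  assumes L: "ceil_log \<sigma> m L" and filtering: "filtering L"
  shows "prepared w \<sigma> x D K (16 * L) (gram_number L) (m - 16 * L * gram_number L) 0
    (gram_table \<sigma> x D K (16 * L) (12 * L))"
proof
  have q: "16 * L * gram_number L < m"
    using filtering unfolding filtering_def by linarith
  then show "1 \<le> m - 16 * L * gram_number L"
    "gram_number L * (16 * L) + (m - 16 * L * gram_number L) \<le> m"
    by (simp_all add: mult.commute)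
  have "1 * gram_number L \<le> 16 * L * gram_number L"
    using L unfolding ceil_log_def by (intro mult_le_mono1) simp
  moreover have "m < 2 ^ w" using m_power_less[of 1] by simp
  ultimately show "gram_number L < 2 ^ w"
    using q by linarith
  show "m + K ^ (16 * L) < 2 ^ w" by (rule table_fits[OF L])
  show "\<exists>b<gram_number L. gram_table \<sigma> x D K (16 * L) (12 * L)
      (gram_code D K t (r + (m - 16 * L * gram_number L) - 1 + b * (16 * L)) (16 * L))"
    if "t \<in> texts \<sigma> n" "r \<le> i" "i < r + (m - 16 * L * gram_number L)" "occurs_at x t i" for t n r i
    by (rule window_step[OF L filtering that])
qed (use x sigma class_less in \<open>auto simp: gram_number_def\<close>)

text \<open>Bounds the probability that a random letter lies in a given class.\<close>

definition hit_probability :: real where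
  "hit_probability = real D / real \<sigma>"

section \<open>Probability that a window is flagged\<close>

lemma hit_probability_bounds: "0 \<le> hit_probability" "hit_probability \<le> 1"
  using D_le sigma by (auto simp: hit_probability_def)

text \<open>If \<open>\<sigma> < m\<close>, the base is \<open>1 / \<sigma>\<close> and
  \<open>\<sigma> ^ L \<ge> m\<close>. Otherwise \<open>L = 1\<close>, and
  \<open>D = \<sigma> div m\<close> gives the bound directly.\<close>

lemma hit_probability_power:
  assumes L: "ceil_log \<sigma> m L"
  shows "hit_probability ^ L \<le> 1 / real m"
proof (cases "\<sigma> < m")
  case True
  then have hit: "hit_probability ^ L = 1 / real (\<sigma> ^ L)"
    by (simp add: hit_probability_def class_width_def power_divide)
  have "real m \<le> real (\<sigma> ^ L)" using L unfolding ceil_log_def by (simp only: of_nat_le_iff)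
  moreover have "0 < real m" "0 < real (\<sigma> ^ L)" using m sigma by (linarith, simp)
  ultimately have "1 / real (\<sigma> ^ L) \<le> 1 / real m" by (intro divide_left_mono mult_pos_pos) auto
  then show ?thesis unfolding hit .
next
  case False
  then have "L = 1" "D = \<sigma> div m" using ceil_log_large_alphabet[OF L] by (auto simp: class_width_def)
  moreover have "\<sigma> div m * m \<le> \<sigma>" by (rule div_times_less_eq_dividend)
  then have "real (\<sigma> div m) * real m \<le> real \<sigma>" by (simp only: of_nat_mult[symmetric] of_nat_le_iff)
  moreover have "0 < real m" "0 < real \<sigma>" using m sigma by linarith+
  ultimately show ?thesis
    by (simp add: hit_probability_def pos_le_divide_eq divide_le_eq mult.commute)
qed

text \<open>More than \<open>4 * L\<close> of the \<open>16 * L\<close> positions carry letters, and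
  the characters facing them are independent, so \<open>hit_probability ^ (4 * L)\<close> is an
  upper bound.\<close>

lemma prob_gram_match:
  assumes L: "ceil_log \<sigma> m L" and i: "i + 16 * L \<le> m" and w: "wildcards x i (16 * L) < 12 * L"
    and p: "p + 16 * L \<le> n"
  shows "measure_pmf.prob (random_text \<sigma> n)
    {t. gram_match \<sigma> x D K i (16 * L) (gram_code D K t p (16 * L))} \<le> 1 / real m ^ 4"
proof -
  let ?l = "16 * L" and ?U = "pmf_of_set {..<\<sigma>}" and ?\<rho> = hit_probability
  \<comment> \<open>The match as a condition on each text position: the class of the facing letter,
    and no condition at wildcards and outside the gram.\<close>
  define S where "S q = (if p \<le> q \<and> q < p + ?l \<and> x ! (i + (q - p)) \<noteq> None
    then {a. a div D = cell (i + (q - p)) div D} else UNIV)" for q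
  define f where "f q = measure_pmf.prob ?U (S q)" for q
  have "measure_pmf.prob (random_text \<sigma> n) {t. gram_match \<sigma> x D K i ?l (gram_code D K t p ?l)}
    \<le> measure_pmf.prob (random_text \<sigma> n) {t. length t = n \<and> (\<forall>q<n. t ! q \<in> S q)}"
  proof (rule measure_pmf.finite_measure_mono_AE)
    show "AE t in measure_pmf (random_text \<sigma> n).
      t \<in> {t. gram_match \<sigma> x D K i ?l (gram_code D K t p ?l)} \<longrightarrow>
      t \<in> {t. length t = n \<and> (\<forall>q<n. t ! q \<in> S q)}"
    proof (rule AE_pmfI, intro impI)
      fix t assume "t \<in> set_pmf (random_text \<sigma> n)"
        and match: "t \<in> {t. gram_match \<sigma> x D K i ?l (gram_code D K t p ?l)}"
      then have t: "t \<in> texts \<sigma> n" using set_random_text(1)[of \<sigma> n] sigma by auto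
      have len: "length t = n" using t by (simp add: texts_def)
      have "gram_match \<sigma> x D K i ?l (gram_code D K t p ?l) \<longleftrightarrow>
        (\<forall>j<?l. cell (i + j) = \<sigma> \<or> cell (i + j) div D = (t ! (p + j)) div D)"
        by (rule gram_match_code, rule class_less, rule texts_nth_less[OF t]) (use p in linarith)
      then have ok: "\<forall>j<?l. cell (i + j) = \<sigma> \<or> cell (i + j) div D = (t ! (p + j)) div D"
        using match by simp
      have "t ! q \<in> S q" for q
      proof (cases "p \<le> q \<and> q < p + ?l \<and> x ! (i + (q - p)) \<noteq> None")
        case True
        define j where "j = q - p"
        have j: "q = p + j" "j < ?l" "x ! (i + j) \<noteq> None" using True by (auto simp: j_def)
        then have "cell (i + j) \<noteq> \<sigma>" using cell_wild[of "i + j"] i by simp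
        then have "cell (i + j) div D = (t ! (p + j)) div D" using ok j(2) by blast
        then show ?thesis using j by (simp add: S_def)
      qed (simp only: S_def if_False UNIV_I)
      then show "t \<in> {t. length t = n \<and> (\<forall>q<n. t ! q \<in> S q)}" using len by simp
    qed
  qed simp
  also have "\<dots> = (\<Prod>q<n. f q)"
    unfolding random_text_def f_def by (rule prob_replicate_pmf)
  also have "\<dots> = (\<Prod>q = p..<p + ?l. f q)"
  proof (rule prod.mono_neutral_right)
    show "\<forall>q\<in>{..<n} - {p..<p + ?l}. f q = 1"
      by (auto simp: f_def S_def)
  qed (use p in auto)
  also have "\<dots> = (\<Prod>j<?l. f (p + j))"
    using prod.shift_bounds_nat_ivl[of f 0 p ?l] by (simp add: lessThan_atLeast0 add.commute)
  \<comment> \<open>The exponent is 1 at a letter and 0 at a wildcard, so the exponents add up to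
    the number of letters.\<close>
  also have "\<dots> \<le> (\<Prod>j<?l. ?\<rho> ^ (1 - of_bool (x ! (i + j) = None)))"
  proof (rule prod_mono)
    fix j assume "j \<in> {..<?l}"
    then show "0 \<le> f (p + j) \<and> f (p + j) \<le> ?\<rho> ^ (1 - of_bool (x ! (i + j) = None))"
      using prob_class_le[of \<sigma> D "cell (i + j) div D"] sigma D_pos
      by (auto simp: f_def S_def hit_probability_def)
  qed
  also have "\<dots> = ?\<rho> ^ (\<Sum>j<?l. 1 - of_bool (x ! (i + j) = None))"
    by (rule power_sum[symmetric])
  also have "(\<Sum>j<?l. 1 - of_bool (x ! (i + j) = None)) = ?l - wildcards x i ?l"
    unfolding wildcards_def by (subst sum_subtractf_nat) auto
  also have "?\<rho> ^ (?l - wildcards x i ?l) \<le> ?\<rho> ^ (L * 4)"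
    using hit_probability_bounds w by (intro power_decreasing) auto
  also have "\<dots> = (?\<rho> ^ L) ^ 4" by (rule power_mult)
  also have "\<dots> \<le> (1 / real m) ^ 4"
    using hit_probability_power[OF L] hit_probability_bounds by (intro power_mono) auto
  finally show ?thesis by (simp add: power_divide)
qed

text \<open>Union bound over the \<open>B\<close> grams of the window and the at most
  \<open>m\<close> places in the pattern.\<close>

lemma prob_flag:
  assumes L: "ceil_log \<sigma> m L" and r: "r + m \<le> n" and filtering: "filtering L"
  shows "measure_pmf.prob (random_text \<sigma> n) {t. window_flag D K (16 * L) (gram_number L)
      (m - 16 * L * gram_number L) 0 (gram_table \<sigma> x D K (16 * L) (12 * L)) t r}
    \<le> real (gram_number L) * real m / real m ^ 4"
proof -
  let ?l = "16 * L" and ?B = "gram_number L"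
  define h where "h = m - ?l * ?B"
  have "?l * ?B < m" using filtering unfolding filtering_def by linarith
  then have h: "1 \<le> h" "?B * ?l + h = m" unfolding h_def by (simp_all add: mult.commute)
  let ?I = "{i. i < m - ?l \<and> wildcards x i ?l < 12 * L}"
  let ?E = "\<lambda>b i. {t. gram_match \<sigma> x D K i ?l (gram_code D K t (r + h - 1 + b * ?l) ?l)}"
  have "{t. window_flag D K ?l ?B h 0 (gram_table \<sigma> x D K ?l (12 * L)) t r} =
      (\<Union>(b, i)\<in>{..<?B} \<times> ?I. ?E b i)"
    by (auto simp: window_flag_def gram_table_def)
  then have "measure_pmf.prob (random_text \<sigma> n)
      {t. window_flag D K ?l ?B h 0 (gram_table \<sigma> x D K ?l (12 * L)) t r}
    \<le> (\<Sum>(b, i)\<in>{..<?B} \<times> ?I. measure_pmf.prob (random_text \<sigma> n) (?E b i))"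
    using measure_pmf.finite_measure_subadditive_finite[of "{..<?B} \<times> ?I"
        "\<lambda>(b, i). ?E b i" "random_text \<sigma> n"]
    by (simp add: case_prod_unfold)
  also have "\<dots> \<le> (\<Sum>(b, i)\<in>{..<?B} \<times> ?I. 1 / real m ^ 4)"
  proof (intro sum_mono, clarify)
    fix b i assume b: "b < ?B" and i: "i < m - ?l" "wildcards x i ?l < 12 * L"
    have "Suc b * ?l \<le> ?B * ?l" using b by (intro mult_le_mono1) simp
    then have "r + h - 1 + b * ?l + ?l \<le> n" using h r by simp
    then show "measure_pmf.prob (random_text \<sigma> n) (?E b i) \<le> 1 / real m ^ 4"
      using i by (intro prob_gram_match[OF L]) auto
  qed
  also have "\<dots> = real (?B * card ?I) * (1 / real m ^ 4)" by (simp add: case_prod_unfold)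
  also have "\<dots> \<le> real (?B * m) * (1 / real m ^ 4)"
  proof -
    have "?I \<subseteq> {..<m}" by auto
    then have "card ?I \<le> m" using card_mono[of "{..<m}" ?I] by simp
    then have "?B * card ?I \<le> ?B * m" by simp
    then have "real (?B * card ?I) \<le> real (?B * m)" by (simp only: of_nat_le_iff)
    then show ?thesis by (rule mult_right_mono) simp
  qed
  finally show ?thesis unfolding h_def by simp
qed

end


section \<open>The average search time\<close>

lemma search_outcome:
  assumes P: "exec w [] P (init_state w \<sigma> x) k\<^sub>0 s\<^sub>0" and outp: "outp s\<^sub>0 = []"
    and ready: "search_ready \<sigma> x D K l B h F table s\<^sub>0"
    and prepared: "prepared w \<sigma> x D K l B h F table"
    and n: "length x \<le> n" "2 * n < 2 ^ w"
  shows "solves_matching w P search_prog \<sigma> n x"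
    and "t \<in> texts \<sigma> n \<Longrightarrow> search_time w P search_prog \<sigma> x t \<le>
      6 + (\<Sum>k<(n - length x) div h + 1. B * (7 * l + 8) + 11 +
        of_bool (window_flag D K l B h F table t (k * h)) * (h * (9 * length x + 10) + 1))"
proof -
  let ?T = "\<lambda>t. 6 + (\<Sum>k<(n - length x) div h + 1. B * (7 * l + 8) + 11 +
        of_bool (window_flag D K l B h F table t (k * h)) * (h * (9 * length x + 10) + 1))"
  have S: "\<exists>k s. exec w t search_prog s\<^sub>0 k s \<and> k \<le> ?T t \<and> set (outp s) = {i. occurs_at x t i}"
    if "t \<in> texts \<sigma> n" for t
  proof -
    interpret prepared w \<sigma> x D K l B h F table by (rule prepared)
    interpret searching w \<sigma> x D K l B h F table t n using that n by unfold_locales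
    show ?thesis using runs_search[OF ready outp] unfolding runs_def by blast
  qed
  show "solves_matching w P search_prog \<sigma> n x"
    unfolding solves_matching_def using P S by blast
  show "search_time w P search_prog \<sigma> x t \<le> ?T t" if t: "t \<in> texts \<sigma> n"
  proof -
    obtain k s where ks: "exec w t search_prog s\<^sub>0 k s" "k \<le> ?T t" using S[OF t] by blast
    \<comment> \<open>Determinism is used twice: for the state left by the preprocessing and for the
      time of the search.\<close>
    have "search_time w P search_prog \<sigma> x t = k"
      unfolding search_time_def
    proof (rule the_equality)
      show "\<exists>k\<^sub>0 s\<^sub>0 s. exec w [] P (init_state w \<sigma> x) k\<^sub>0 s\<^sub>0 \<and> exec w t search_prog s\<^sub>0 k s"
        using P ks(1) by blast
      fix k' assume "\<exists>k\<^sub>0 s\<^sub>0 s. exec w [] P (init_state w \<sigma> x) k\<^sub>0 s\<^sub>0 \<and> exec w t search_prog s\<^sub>0 k' s"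
      then obtain k1 s1 s' where "exec w [] P (init_state w \<sigma> x) k1 s1" "exec w t search_prog s1 k' s'"
        by blast
      moreover from this(1) have "s1 = s\<^sub>0" using exec_deterministic[OF P] by blast
      ultimately show "k' = k" using exec_deterministic[OF ks(1)] by blast
    qed
    then show ?thesis using ks(2) by simp
  qed
qed

lemma expectation_mono_texts:
  assumes "0 < \<sigma>" "\<And>t. t \<in> texts \<sigma> n \<Longrightarrow> f t \<le> (g t :: real)"
  shows "measure_pmf.expectation (random_text \<sigma> n) f \<le> measure_pmf.expectation (random_text \<sigma> n) g"
  using set_random_text[OF assms(1), of n] assms(2)
  by (intro integral_mono_AE) (auto intro!: integrable_measure_pmf_finite simp: AE_measure_pmf_iff)

text \<open>Linearity of expectation; the flags of different windows may be dependent.\<close>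

lemma avg_search_time_le:
  assumes sigma: "0 < \<sigma>"
    and time: "\<And>t. t \<in> texts \<sigma> n \<Longrightarrow> search_time w P S \<sigma> x t \<le>
      a + (\<Sum>k<N. b + of_bool (flag t (k :: nat)) * c)"
    and prob: "\<And>k. k < N \<Longrightarrow> measure_pmf.prob (random_text \<sigma> n) {t. flag t k} \<le> p"
  shows "avg_search_time w P S \<sigma> n x \<le> real a + real N * (real b + p * real c)"
proof -
  let ?M = "random_text \<sigma> n"
  have fin: "finite (set_pmf ?M)" using set_random_text[OF sigma, of n] by simp
  have int: "integrable (measure_pmf ?M) (f :: nat list \<Rightarrow> real)" for f
    by (rule integrable_measure_pmf_finite[OF fin])
  have "avg_search_time w P S \<sigma> n x \<le>
      measure_pmf.expectation ?M (\<lambda>t. real a + (\<Sum>k<N. real b + of_bool (flag t k) * real c))"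
    unfolding avg_search_time_def
  proof (rule expectation_mono_texts[OF sigma])
    fix t assume "t \<in> texts \<sigma> n"
    then have "real (search_time w P S \<sigma> x t) \<le> real (a + (\<Sum>k<N. b + of_bool (flag t k) * c))"
      using time by (simp only: of_nat_le_iff)
    then show "real (search_time w P S \<sigma> x t) \<le> real a + (\<Sum>k<N. real b + of_bool (flag t k) * real c)"
      by simp
  qed
  also have "\<dots> = real a + (\<Sum>k<N. real b + measure_pmf.prob ?M {t. flag t k} * real c)"
  proof -
    have "of_bool (flag t k) = (indicator {t. flag t k} t :: real)" for t k
      by (simp add: indicator_def)
    then show ?thesis by (simp add: int Bochner_Integration.integral_sum)
  qed
  also have "\<dots> \<le> real a + (\<Sum>k<N. real b + p * real c)"
    using prob by (intro add_left_mono sum_mono mult_right_mono) auto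
  finally show ?thesis by simp
qed

section \<open>The time bounds in terms of \<open>cost_bound\<close>\<close>

lemma cost_bound_ge:
  assumes "0 < m"
  shows "real n / real m \<le> cost_bound \<sigma> m g n"
proof -
  have "real n / real m * 1 \<le> real n / real m * (real g + max 1 (log (real \<sigma>) (real m)))"
    by (intro mult_left_mono) auto
  then show ?thesis by (simp add: cost_bound_def)
qed

text \<open>Verifying all positions costs at most \<open>37 * n * m\<close>, which is
  \<open>37 * m ^ 2\<close> times \<open>n / m\<close>; for \<open>m \<le> 2500\<close> this factor
  is below 250000000.\<close>

lemma naive_time_le:
  assumes sigma: "0 < \<sigma>" and m: "1 \<le> m" "m \<le> n" "m \<le> 2500"
    and time: "\<And>t. t \<in> texts \<sigma> n \<Longrightarrow> search_time w P S \<sigma> x t \<le>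
      6 + (\<Sum>k<(n - m) div 1 + 1. 0 * (7 * 0 + 8) + 11 + of_bool (flag t k) * (1 * (9 * m + 10) + 1))"
  shows "avg_search_time w P S \<sigma> n x \<le> 250000000 * cost_bound \<sigma> m g n"
proof -
  have "avg_search_time w P S \<sigma> n x \<le> real 6 + real ((n - m) div 1 + 1) *
      (real (0 * (7 * 0 + 8) + 11) + 1 * real (1 * (9 * m + 10) + 1))"
    by (rule avg_search_time_le[OF sigma time]) auto
  also have "\<dots> \<le> 6 + real n * (9 * real m + 22)"
  proof -
    have "(n - m) div 1 + 1 \<le> n" using m by simp
    then have "real ((n - m) div 1 + 1) \<le> real n" by (simp only: of_nat_le_iff)
    then have "real ((n - m) div 1 + 1) * (9 * real m + 22) \<le> real n * (9 * real m + 22)"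
      by (rule mult_right_mono) simp
    then show ?thesis by (simp add: algebra_simps)
  qed
  also have "\<dots> \<le> real n * (37 * real m)"
  proof -
    have "6 + n * (9 * m + 22) \<le> n * 6 + n * (9 * m + 22)" using m by simp
    also have "\<dots> = n * (9 * m + 28)" by (simp add: algebra_simps)
    also have "\<dots> \<le> n * (37 * m)" using m by (intro mult_left_mono) auto
    finally have "real (6 + n * (9 * m + 22)) \<le> real (n * (37 * m))" by (simp only: of_nat_le_iff)
    then show ?thesis by simp
  qed
  also have "\<dots> = 37 * (real m * real m) * (real n / real m)" using m by simp
  also have "\<dots> \<le> 37 * (2500 * 2500) * (real n / real m)"
    using m by (intro mult_right_mono mult_left_mono mult_mono) auto
  also have "\<dots> \<le> 250000000 * (real n / real m)" by (intro mult_right_mono) auto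
  also have "\<dots> \<le> 250000000 * cost_bound \<sigma> m g n"
    using cost_bound_ge[of m n \<sigma> g] m by (intro mult_left_mono) auto
  finally show ?thesis .
qed

context preprocessing
begin

lemma ceil_log_le:
  assumes "ceil_log \<sigma> m L"
  shows "real L \<le> 2 * max 1 (log (real \<sigma>) (real m))"
proof (cases "1 < L")
  case True
  then have "\<sigma> ^ (L - 1) \<le> m" using assms by (simp add: ceil_log_def)
  then have "real \<sigma> ^ (L - 1) \<le> real m" by (simp only: of_nat_power[symmetric] of_nat_le_iff)
  then have "real \<sigma> powr real (L - 1) \<le> real m" using sigma by (simp add: powr_realpow)
  then have "real (L - 1) \<le> log (real \<sigma>) (real m)"
    using sigma m by (subst le_log_iff) auto
  then show ?thesis using True by (simp add: of_nat_diff)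
qed (use assms in \<open>auto simp: ceil_log_def\<close>)

text \<open>From \<open>3 * m \<le> 64 * L * B\<close>, \<open>12 * L * (B - 1) \<le> g\<close> and
  \<open>2 * g < m\<close> it follows that \<open>m < 192 * L\<close>. As
  \<open>2 ^ (L - 1) < m\<close> for \<open>L > 1\<close>, this forces
  \<open>L \<le> 12\<close>.\<close>

lemma not_filtering_small:
  assumes L: "ceil_log \<sigma> m L" and "\<not> filtering L" and g: "2 * g < m"
  shows "m \<le> 2500"
proof -
  define d where "d = g div (12 * L)"
  have "d * (12 * L) \<le> g" unfolding d_def by (rule div_times_less_eq_dividend)
  then have "12 * (L * d) \<le> g" by (simp add: mult.commute mult.left_commute)
  moreover have "3 * m \<le> 64 * (L * d) + 64 * L"
    using assms(2) unfolding filtering_def gram_number_def d_def[symmetric]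
    by (simp add: algebra_simps not_less)
  ultimately have mL: "m < 192 * L" using g by linarith
  have "192 * L \<le> 2 ^ (L - 1)" if "13 \<le> L"
    using that
  proof (induction L rule: dec_induct)
    case (step L)
    have "(2 :: nat) ^ (L - 1) \<ge> 192" using step power_increasing[of 12 "L - 1" "2 :: nat"] by simp
    moreover have "(2 :: nat) ^ (Suc L - 1) = 2 * 2 ^ (L - 1)" using step by (cases L) auto
    ultimately show ?case using step by simp
  qed simp
  moreover have "2 ^ (L - 1) < m" if "1 < L"
  proof -
    have "(2 :: nat) ^ (L - 1) \<le> \<sigma> ^ (L - 1)" using sigma by (intro power_mono) auto
    then show ?thesis using L that unfolding ceil_log_def by linarith
  qed
  ultimately have "\<not> 13 \<le> L" using mL by force
  then show ?thesis using mL by linarith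
qed

text \<open>There are \<open>O(n / m)\<close> windows. Each reads
  \<open>q = 16 * L * B = O(g + L)\<close> characters, and its verification costs
  \<open>O(m ^ 2)\<close> with probability at most \<open>B / m ^ 3\<close>, hence
  \<open>O(1)\<close> on average.\<close>

lemma filtering_time_le:
  assumes L: "ceil_log \<sigma> m L" and filtering: "filtering L" and n: "m \<le> n"
    and time: "\<And>t. t \<in> texts \<sigma> n \<Longrightarrow> search_time w P S \<sigma> x t \<le>
      6 + (\<Sum>k<(n - m) div (m - 16 * L * gram_number L) + 1. gram_number L * (7 * (16 * L) + 8) + 11 +
        of_bool (window_flag D K (16 * L) (gram_number L) (m - 16 * L * gram_number L) 0
          (gram_table \<sigma> x D K (16 * L) (12 * L)) t (k * (m - 16 * L * gram_number L))) *
        ((m - 16 * L * gram_number L) * (9 * m + 10) + 1))"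
  shows "avg_search_time w P S \<sigma> n x \<le> 250000000 * cost_bound \<sigma> m g n"
proof -
  define B l where "B = gram_number L" and "l = 16 * L"
  define h where "h = m - l * B"
  define N where "N = (n - m) div h + 1"
  define q where "q = l * B"
  define M where "M = max 1 (log (real \<sigma>) (real m))"
  have q: "4 * q < 3 * m" using filtering unfolding filtering_def q_def l_def B_def by linarith
  then have h: "1 \<le> h" "h \<le> m" "m \<le> 4 * h" "h + q = m" unfolding h_def q_def[symmetric] by linarith+
  have "1 \<le> L" "1 \<le> B" using L by (auto simp: ceil_log_def B_def gram_number_def)
  then have l: "16 \<le> l" unfolding l_def by simp
  have "16 * 1 \<le> l * B" using l \<open>1 \<le> B\<close> by (intro mult_mono) auto
  then have q1: "16 \<le> q" by (simp add: q_def)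
  have "1 * B \<le> l * B" using l by (intro mult_le_mono1) simp
  then have "B \<le> q" by (simp add: q_def)
  then have "B \<le> m" using q by linarith
  define p where "p = real B * real m / real m ^ 4"
  have "avg_search_time w P S \<sigma> n x \<le>
      real 6 + real N * (real (B * (7 * l + 8) + 11) + p * real (h * (9 * m + 10) + 1))"
  proof (rule avg_search_time_le)
    show "0 < \<sigma>" using sigma by simp
    show "search_time w P S \<sigma> x t \<le> 6 + (\<Sum>k<N. B * (7 * l + 8) + 11 +
      of_bool (window_flag D K l B h 0 (gram_table \<sigma> x D K l (12 * L)) t (k * h)) * (h * (9 * m + 10) + 1))"
      if "t \<in> texts \<sigma> n" for t
      using time[OF that] unfolding N_def h_def l_def B_def .
    fix k assume "k < N"
    then have "k \<le> (n - m) div h" unfolding N_def by simp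
    then have "k * h \<le> (n - m) div h * h" by (rule mult_le_mono1)
    also have "\<dots> \<le> n - m" by (rule div_times_less_eq_dividend)
    finally have "k * h + m \<le> n" using n by linarith
    then show "measure_pmf.prob (random_text \<sigma> n)
        {t. window_flag D K l B h 0 (gram_table \<sigma> x D K l (12 * L)) t (k * h)} \<le> p"
      unfolding p_def h_def l_def B_def by (rule prob_flag[OF L _ filtering])
  qed
  also have "\<dots> \<le> real N * (52 * real q)"
  proof -
    have m0: "0 < real m" using m by linarith
    have "h * (9 * m + 10) + 1 \<le> m * (9 * m + 10) + m * 1"
      using h m by (intro add_mono mult_le_mono1) auto
    also have "\<dots> = m * (9 * m + 11)" by (simp add: algebra_simps)
    also have "\<dots> \<le> m * (20 * m)" using m by (intro mult_le_mono2) linarith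
    finally have "real (h * (9 * m + 10) + 1) \<le> real (m * (20 * m))" by (simp only: of_nat_le_iff)
    then have "p * real (h * (9 * m + 10) + 1) \<le> p * real (m * (20 * m))"
      by (rule mult_left_mono) (simp add: p_def)
    also have "\<dots> = 20 * (real B / real m)"
      using m0 by (simp add: p_def field_simps power4_eq_xxxx)
    also have "real B / real m \<le> 1" using \<open>B \<le> m\<close> m0 by simp
    finally have ver: "p * real (h * (9 * m + 10) + 1) \<le> 20" by simp
    have "B * (7 * l + 8) + 11 \<le> 7 * q + 8 * q + 11"
      using \<open>B \<le> q\<close> by (simp add: q_def algebra_simps)
    then have "real (B * (7 * l + 8) + 11) \<le> real (15 * q + 11)"
      by (simp only: of_nat_le_iff)
    then have "real (B * (7 * l + 8) + 11) + p * real (h * (9 * m + 10) + 1) \<le> 15 * real q + 31"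
      using ver by simp
    then have "real N * (real (B * (7 * l + 8) + 11) + p * real (h * (9 * m + 10) + 1))
        \<le> real N * (15 * real q + 31)" by (rule mult_left_mono) simp
    \<comment> \<open>The initial 6 time units are charged to one of the \<open>N \<ge> 1\<close>
      windows; 52 = 15 + 37 then uses \<open>q \<ge> 1\<close>.\<close>
    moreover have "6 + real N * (15 * real q + 31) \<le> real N * (15 * real q + 37)"
      by (simp add: N_def algebra_simps)
    moreover have "real N * (15 * real q + 37) \<le> real N * (52 * real q)"
      using q1 by (intro mult_left_mono) auto
    ultimately show ?thesis by linarith
  qed
  also have "\<dots> \<le> (4 * (real n / real m)) * (52 * (32 * (real g + M)))"
  proof (rule mult_mono)
    have "(n - m) div h * h + h \<le> (n - m) + m"
      using h(2) by (intro add_mono div_times_less_eq_dividend)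
    then have "N * h \<le> n" using n by (simp add: N_def)
    moreover have "N * m \<le> N * (4 * h)" using h(3) by (rule mult_le_mono2)
    moreover have "N * (4 * h) = 4 * (N * h)" by simp
    ultimately have "N * m \<le> 4 * n" by linarith
    then have "real (N * m) \<le> real (4 * n)" by (simp only: of_nat_le_iff)
    moreover have "0 < real m" using m by linarith
    ultimately show "real N \<le> 4 * (real n / real m)" by (simp add: field_simps)
    define d where "d = g div (12 * L)"
    have "d * (12 * L) \<le> g" unfolding d_def by (rule div_times_less_eq_dividend)
    moreover have "q = 16 * (L * d) + 16 * L"
      unfolding q_def l_def B_def gram_number_def d_def[symmetric] by (simp add: algebra_simps)
    moreover have "d * (12 * L) = 12 * (L * d)" by simp
    ultimately have "q \<le> 2 * g + 16 * L" by linarith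
    then have "real q \<le> real (2 * g + 16 * L)" by (simp only: of_nat_le_iff)
    then have "real q \<le> 2 * real g + 16 * real L" by simp
    moreover have "real L \<le> 2 * M" unfolding M_def by (rule ceil_log_le[OF L])
    ultimately have "real q \<le> 32 * (real g + M)" by simp
    then show "52 * real q \<le> 52 * (32 * (real g + M))" by simp
  qed (simp_all add: M_def)
  \<comment> \<open>6656 = 4 * 52 * 32; it is enlarged to the constant of the mode that verifies
    every position.\<close>
  also have "\<dots> = 6656 * cost_bound \<sigma> m g n"
    by (simp add: cost_bound_def M_def)
  also have "\<dots> \<le> 250000000 * cost_bound \<sigma> m g n"
    by (rule mult_right_mono) (simp_all add: cost_bound_def)
  finally show ?thesis .
qed

end

text \<open>The word size enters as \<open>n ^ 100 \<le> 2 ^ w\<close>, from which the bounds on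
  powers of \<open>m\<close> follow.\<close>

lemma preprocess_search_correct:
  assumes sigma: "2 \<le> \<sigma>" "\<sigma> < 2 ^ w" and g: "g < m" and n: "m \<le> n"
    and w: "100 * log 2 (real n) \<le> real w" and x: "x \<in> patterns \<sigma> m g"
  shows "solves_matching w preprocess_prog search_prog \<sigma> n x \<and>
    (2 * g < m \<longrightarrow>
      avg_search_time w preprocess_prog search_prog \<sigma> n x \<le> 250000000 * cost_bound \<sigma> m g n)"
proof -
  have len: "length x = m" and xs: "set x \<subseteq> insert None (Some ` {..<\<sigma>})" and gx: "count_list x None = g"
    using x unfolding patterns_def by blast+
  have "2 powr (100 * log 2 (real n)) \<le> 2 powr real w" using w by simp
  moreover have "2 powr (100 * log 2 (real n)) = real n ^ 100"
    using g n by (simp add: powr_powr[symmetric] mult.commute[of 100] powr_numeral)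
  ultimately have "real n ^ 100 \<le> real (2 ^ w)" by (simp add: powr_realpow)
  then have n_power: "n ^ 100 \<le> 2 ^ w" by (simp only: of_nat_power[symmetric] of_nat_le_iff)
  \<comment> \<open>For \<open>n = 1\<close> powers of \<open>n\<close> give no room, and
    \<open>2 \<le> \<sigma> < 2 ^ w\<close> is used instead.\<close>
  have "2 * n < 2 ^ w"
  proof (cases "n = 1")
    case True
    then show ?thesis using sigma by linarith
  next
    case False
    then have "2 \<le> n" using g n by linarith
    then have "2 * n \<le> n ^ 2" by (simp add: power2_eq_square)
    also have "\<dots> < n ^ 100" using \<open>2 \<le> n\<close> by (intro power_strict_increasing) auto
    finally show ?thesis using n_power by (rule less_le_trans)
  qed
  note n' = n[folded len] this
  show ?thesis
  proof (cases "m = 1")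
    case True
    obtain k s where P: "exec w [] preprocess_prog (init_state w \<sigma> x) k s" and outp: "outp s = []"
      and ready: "search_ready \<sigma> x 0 0 0 0 1 1 (\<lambda>_. False) s"
      using halts_preprocess_singleton[of x \<sigma> w] sigma len True unfolding halts_def runs_def by blast
    have prep: "prepared w \<sigma> x 0 0 0 0 1 1 (\<lambda>_. False)"
      by (rule prepared_naive[OF xs sigma(2)]) (simp add: len True)
    note out = search_outcome[OF P outp ready prep n']
    have "avg_search_time w preprocess_prog search_prog \<sigma> n x \<le> 250000000 * cost_bound \<sigma> m g n"
      by (rule naive_time_le[OF _ _ n _ out(2)[unfolded len]]) (use sigma True in simp_all)
    then show ?thesis using out(1) by blast
  next
    case False
    have m2: "2 \<le> m" using g False by linarith
    interpret preprocessing w \<sigma> x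
    proof
      show "length x ^ k < 2 ^ w" if "k < 100" for k
      proof -
        have "m ^ k < m ^ 100" using that m2 by (intro power_strict_increasing) auto
        also have "\<dots> \<le> n ^ 100" using n by (rule power_mono) simp
        finally show ?thesis using n_power len by (metis less_le_trans)
      qed
    qed (use xs sigma m2 len in auto)
    obtain k s L where P: "exec w [] preprocess_prog (init_state w \<sigma> x) k s"
      and L: "ceil_log \<sigma> (length x) L" and s: "preprocessed L s"
      using halts_preprocess unfolding halts_def runs_def by blast
    have outp: "outp s = []" using s by (simp add: preprocessed_def)
    show ?thesis
    proof (cases "filtering L")
      case True
      then have ready: "search_ready \<sigma> x (class_width \<sigma> (length x)) (class_count \<sigma> (length x)) (16 * L)
          (gram_number L) (length x - 16 * L * gram_number L) 0
          (gram_table \<sigma> x (class_width \<sigma> (length x)) (class_count \<sigma> (length x)) (16 * L) (12 * L)) s"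
        using s by (simp add: preprocessed_def)
      note out = search_outcome[OF P outp ready prepared_filtering[OF L True] n']
      show ?thesis
        using out(1) filtering_time_le[OF L True n'(1) out(2)] by (simp add: len gx)
    next
      case nf: False
      then have ready: "search_ready \<sigma> x (class_width \<sigma> (length x)) (class_count \<sigma> (length x)) 0 0 1 1
          (\<lambda>_. False) s"
        using s by (simp add: preprocessed_def)
      have prep: "prepared w \<sigma> x (class_width \<sigma> (length x)) (class_count \<sigma> (length x)) 0 0 1 1 (\<lambda>_. False)"
        by (rule prepared_naive[OF xs sigma(2)]) (use m2 len in simp)
      note out = search_outcome[OF P outp ready prep n']
      have "avg_search_time w preprocess_prog search_prog \<sigma> n x \<le> 250000000 * cost_bound \<sigma> m g n"
        if "2 * g < m"
      proof (rule naive_time_le[OF _ _ n _ out(2)[unfolded len]])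
        show "m \<le> 2500" using not_filtering_small[OF L nf] that by (simp add: len gx)
      qed (use sigma m2 in simp_all)
      then show ?thesis using out(1) by blast
    qed
  qed
qed

theorem theorem8:
  shows
    "(\<exists>(P :: prog) (S :: prog) (c :: real) (C :: real). c > 0 \<and> C > 0 \<and>
        (\<forall>(\<sigma> :: nat) (m :: nat) (g :: nat) (n :: nat) (w :: nat).
           2 \<le> \<sigma> \<longrightarrow> g < m \<longrightarrow> m \<le> n \<longrightarrow> c * log 2 (real n) \<le> real w \<longrightarrow> \<sigma> < 2 ^ w \<longrightarrow>
             (\<forall>x\<in>patterns \<sigma> m g.
                solves_matching w P S \<sigma> n x \<and>
                (real g / real m < 1 / 2 - 3 * log (real \<sigma>) (real m) / real m \<longrightarrow>
                   avg_search_time w P S \<sigma> n x \<le> C * cost_bound \<sigma> m g n))))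
     \<and>
     (\<exists>c :: real. c > 0 \<and>
        (\<forall>(\<sigma> :: nat) (m :: nat) (g :: nat) (n :: nat) (\<pi> :: nat list) (V :: verdict).
           2 \<le> \<sigma> \<longrightarrow> g < m \<longrightarrow> 2 * m \<le> n \<longrightarrow> fixed_algorithm \<sigma> m g \<pi> V \<longrightarrow>
             (\<exists>x\<in>patterns \<sigma> m g.
                avg_inspections \<sigma> m \<pi> V x n \<ge> c * cost_bound \<sigma> m g n)))"
proof (rule conjI, goal_cases)
  case 1
  show ?case
  proof (rule exI[of _ preprocess_prog], rule exI[of _ search_prog], rule exI[of _ 100],
      rule exI[of _ 250000000], intro conjI allI impI ballI)
    fix \<sigma> m g n w x
    assume *: "2 \<le> \<sigma>" "g < m" "m \<le> n" "100 * log 2 (real n) \<le> real w" "\<sigma> < 2 ^ w"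
      "x \<in> patterns \<sigma> m g"
    note correct = preprocess_search_correct[OF *(1,5,2,3,4,6)]
    show "solves_matching w preprocess_prog search_prog \<sigma> n x" using correct by blast
    assume "real g / real m < 1 / 2 - 3 * log (real \<sigma>) (real m) / real m"
    \<comment> \<open>As the subtracted logarithm is nonnegative, the range of the time bound gives
      \<open>2 * g < m\<close>.\<close>
    moreover have "0 \<le> 3 * log (real \<sigma>) (real m) / real m" using *(1,2) by simp
    ultimately have "real g / real m < 1 / 2" by linarith
    then have "2 * g < m" using *(2) by (simp add: field_simps)
    then show "avg_search_time w preprocess_prog search_prog \<sigma> n x \<le> 250000000 * cost_bound \<sigma> m g n"
      using correct by blast
  qed simp_all
next
  case 2
  show ?case
    by (rule exI[of _ "1 / 24"]) (use fixed_algorithm_lower_bound in simp)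
qed

end
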